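(* Let $P(t)\in\mathbb{R}[t]$ be a non-constant real polynomial all of whose (complex) zeros are positive real numbers, with $P(0)>0$, and let $r$ be a positive integer such that $\max\{\deg P,r\}>1$. Let $R(t)=t^{2r}\frac{d}{dt}\left(-P(t)/t^{r}\right)=rt^{r-1}P(t)-t^{r}P'(t)$, let $t_a$ be the smallest positive real zero of $R(t)$ and let $t_b$ be the largest nonpositive real zero of $R(t)$. Put $a=-P(t_a)/t_a^{r}$ and $$b=\begin{cases}-P(t_b)/t_b & \text{if } t_b\neq 0,\\ \infty & \text{if } t_b=0.\end{cases}$$ Let $\{H_m(z)\}_{m=0}^\infty$ be the sequence of polynomials generated by $$\sum_{m=0}^{\infty}H_m(z)t^m=\frac{1}{P(t)+zt^r}.$$ Then there is an integer $M$ such that for every $m\ge M$ all (complex) zeros of $H_m(z)$ lie in the real interval $(a,b)$. Moreover, the set $\mathcal{Z}=\bigcup_{m\ge M}\{z : H_m(z)=0\}$ is dense in $(a,b)$.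
   Context: The generating relation is an identity of formal power series in $t$ with coefficients in $\mathbb{R}[z]$ (note $P(0)\ne0$). When $r=1$ one has $t_b<0$, and when $r>1$ one has $t_b=0$. *)

theory Defs
  imports
    "HOL-Analysis.Analysis"
    "HOL-Computational_Algebra.Polynomial_FPS"
    "HOL-Library.Extended_Real"
begin

definition R_poly :: "real poly \<Rightarrow> nat \<Rightarrow> real poly" where
  "R_poly P r = smult (real r) (monom 1 (r - 1) * P) - monom 1 r * pderiv P"

lemma R_poly_eq_deriv:
  assumes "t \<noteq> 0"
  shows "poly (R_poly P r) t = t ^ (2 * r) * deriv (\<lambda>s. - poly P s / s ^ r) t"
proof -
  have pw: "((\<lambda>s. s ^ r) has_field_derivative real r * t ^ (r - 1)) (at t)"
    using DERIV_pow[of r t] by simp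
  have "((\<lambda>s. - poly P s / s ^ r) has_field_derivative
      (- poly (pderiv P) t * t ^ r - (- poly P t) * (real r * t ^ (r - 1))) / (t ^ r * t ^ r)) (at t)"
    using assms by (intro DERIV_divide DERIV_minus poly_DERIV pw) auto
  then have "((\<lambda>s. - poly P s / s ^ r) has_field_derivative
      (- poly (pderiv P) t * t ^ r + poly P t * (real r * t ^ (r - 1))) / (t ^ r * t ^ r)) (at t)"
    by simp
  then have "deriv (\<lambda>s. - poly P s / s ^ r) t =
      (- poly (pderiv P) t * t ^ r + poly P t * (real r * t ^ (r - 1))) / (t ^ r * t ^ r)"
    by (rule DERIV_imp_deriv)
  moreover have "t ^ (2 * r) = t ^ r * t ^ r"
    by (simp add: mult_2 power_add)
  ultimately have "t ^ (2 * r) * deriv (\<lambda>s. - poly P s / s ^ r) t =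
      - poly (pderiv P) t * t ^ r + poly P t * (real r * t ^ (r - 1))"
    using assms by simp
  then show ?thesis
    by (simp add: R_poly_def poly_monom)
qed

lemma R_poly_nonzero:
  assumes "r > 0" and "poly P 0 \<noteq> 0"
  shows "R_poly P r \<noteq> 0"
proof
  assume "R_poly P r = 0"
  then have "coeff (R_poly P r) (r - 1) = 0"
    by simp
  then show False
    using assms by (simp add: R_poly_def coeff_monom_mult poly_0_coeff_0)
qed

text \<open>
  If \<open>r > 0\<close> and \<open>P(0) \<noteq> 0\<close>, then \<open>R_poly P r\<close> is a nonzero polynomial, so the sets below are
  finite. They are nonempty when all complex zeros of \<open>P\<close> are positive reals, \<open>degree P > 0\<close> and
  \<open>max (degree P) r > 1\<close>.
\<close>

definition t_a :: "real poly \<Rightarrow> nat \<Rightarrow> real" where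
  "t_a P r = Min {t. 0 < t \<and> poly (R_poly P r) t = 0}"

definition t_b :: "real poly \<Rightarrow> nat \<Rightarrow> real" where
  "t_b P r = Max {t. t \<le> 0 \<and> poly (R_poly P r) t = 0}"

definition endpoint_a :: "real poly \<Rightarrow> nat \<Rightarrow> real" where
  "endpoint_a P r = - poly P (t_a P r) / t_a P r ^ r"

text \<open>
  The second endpoint has the denominator \<open>t_b\<close> without the exponent \<open>r\<close>: the case \<open>t_b \<noteq> 0\<close>
  occurs only for \<open>r = 1\<close>, since \<open>0\<close> is a zero of \<open>R_poly P r\<close> when \<open>r > 1\<close>.
\<close>

definition endpoint_b :: "real poly \<Rightarrow> nat \<Rightarrow> ereal" where
  "endpoint_b P r = (if t_b P r \<noteq> 0 then ereal (- poly P (t_b P r) / t_b P r) else \<infinity>)"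

text \<open>The open interval from \<open>a\<close> to \<open>b\<close> (possibly infinite) on the real axis of the complex plane.\<close>

definition real_interval :: "real \<Rightarrow> ereal \<Rightarrow> complex set" where
  "real_interval a b = complex_of_real ` {x. a < x \<and> ereal x < b}"

definition complex_zeros :: "real poly \<Rightarrow> complex set" where
  "complex_zeros p = {z. poly (map_poly complex_of_real p) z = 0}"

text \<open>
  \<open>P(t) + z t\<^sup>r\<close> as a power series in \<open>t\<close> with coefficients in \<open>\<real>[z]\<close>: each coefficient of \<open>P\<close>
  becomes a constant polynomial, and \<open>[:0, 1:]\<close> is the variable \<open>z\<close>.
\<close>

definition denom_fps :: "real poly \<Rightarrow> nat \<Rightarrow> real poly fps" where
  "denom_fps P r = fps_of_poly (map_poly (\<lambda>c. [:c:]) P) + fps_const [:0, 1:] * fps_X ^ r"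

text \<open>
  Division is not available for power series over \<open>\<real>[z]\<close>, which is not a field, so being equal to
  \<open>1 / (P(t) + z t\<^sup>r)\<close> is expressed as being the multiplicative inverse of the denominator.
\<close>

definition generated_by :: "(nat \<Rightarrow> real poly) \<Rightarrow> real poly \<Rightarrow> nat \<Rightarrow> bool" where
  "generated_by H P r \<longleftrightarrow> Abs_fps H * denom_fps P r = 1"

end

theory Submission
  imports Defs "HOL-Complex_Analysis.Laurent_Convergence"
    "HOL-Computational_Algebra.Fundamental_Theorem_Algebra"
begin

text \<open>
  All zeros are real, for every \<open>m\<close>. With \<open>h(t) = \<Sum> H\<^sub>m(z) t\<^sup>m\<close> we have \<open>P h = 1 - z t\<^sup>r h\<close>, and dividing by a
  factor \<open>1 - a t\<close> with \<open>a > 0\<close> does not increase the number of sign changes of a real sequence.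
  If \<open>H\<^sub>m(z) = 0\<close>, then the number of sign changes of \<open>Re (w H\<^sub>j(z))\<close>, \<open>j \<le> m\<close>, does not decrease when the
  complex number \<open>w\<close> is replaced by \<open>- z w\<close>, and it increases for \<open>w = \<i>\<close> if \<open>z\<close> is not real. The powers
  of \<open>- z / \<bar>z\<bar>\<close> return arbitrarily close to 1 and the number of sign changes is lower semicontinuous,
  so it would grow without bound.

  For real \<open>z\<close> outside \<open>(a,b)\<close> the coefficients of \<open>1 / (P(t) + z t\<^sup>r)\<close>, or of the same series at \<open>- t\<close>, are
  positive. For \<open>z\<close> inside \<open>(a,b)\<close> the root \<open>t\<close> of \<open>P(t) + z t\<^sup>r\<close> of smallest modulus is not real: it moves
  continuously as \<open>z\<close> runs from \<open>-1\<close> through the upper half plane, where the argument of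
  \<open>P(t) / t\<^sup>r\<close> cannot reach \<open>- \<pi>\<close>. Hence \<open>H\<^sub>m(z)\<close> behaves like \<open>\<bar>t\<bar>\<^sup>-\<^sup>m\<close> times a sine of frequency \<open>arg t\<close>, up to
  an error of smaller order. On a subinterval without zeros of any \<open>H\<^sub>m\<close> the signs of \<open>H\<^sub>m\<close> would not
  depend on \<open>z\<close>, so neither would the frequency, which leaves only finitely many \<open>t\<close>.
\<close>

subsection \<open>Sign changes and real zeros\<close>

text \<open>The zeros of \<open>P\<close> enter through their reciprocals \<open>a\<close>, so that
  each factor \<open>1 - a t\<close> has constant term 1: the product is invertible as a power
  series and the leading constant is \<open>P(0)\<close>. Sign changes are counted for real
  sequences, whereas the values \<open>H_j(z)\<close> are complex; this is the reason for the
  auxiliary number \<open>w\<close>. A change is gained only at a purely imaginary \<open>w\<close>,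
  where the constant term \<open>Re w\<close> vanishes, so the iteration has to come back to
  \<open>\<i>\<close> before it can gain again. The bound that makes the smallest root nonreal is
  2\<pi>: for a parameter in \<open>(a,b)\<close> a real root has
  \<open>\<Phi> \<ge> 2\<pi>\<close>, while the path starts with \<open>\<Phi> = 0\<close>. The
  asymptotics are pointwise in \<open>z\<close>. No uniformity enters, because the density argument
  compares only the signs of \<open>H_m\<close> at two fixed points.\<close>

definition lin_prod :: "'a::comm_ring_1 list \<Rightarrow> 'a poly" where
  "lin_prod as = prod_list (map (\<lambda>a. [:1, - a:]) as)"

lemma lin_prod_simps [simp]:
  "lin_prod [] = 1" "lin_prod (a # as) = [:1, - a:] * lin_prod as"
  by (simp_all add: lin_prod_def)

text \<open>Here \<open>k\<close> counts the sign changes ending at index \<open>i\<close>, and \<open>s\<close> only matters through its sign,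
  which is that of \<open>x i\<close>.\<close>

primrec alternates :: "(nat \<Rightarrow> real) \<Rightarrow> nat \<Rightarrow> nat \<Rightarrow> real \<Rightarrow> bool" where
  "alternates x 0 i s \<longleftrightarrow> 0 < s * x i"
| "alternates x (Suc k) i s \<longleftrightarrow> 0 < s * x i \<and> (\<exists>j<i. alternates x k j (- s))"

lemma alternates_last: "alternates x k i s \<Longrightarrow> 0 < s * x i"
  by (cases k) auto

lemma alternates_le: "alternates x k i s \<Longrightarrow> k \<le> i"
  by (induction k arbitrary: i s) fastforce+

lemma alternates_scale:
  assumes "\<rho> > 0" "\<And>j. y j = \<rho> * x j" "alternates x k i s"
  shows "alternates y k i s"
  using assms(3)
proof (induction k arbitrary: i s)
  case 0
  moreover have "s * y i = \<rho> * (s * x i)"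
    by (simp add: assms(2))
  ultimately show ?case
    using assms(1) by (metis alternates.simps(1) mult_pos_pos)
next
  case (Suc k)
  moreover have "s * y i = \<rho> * (s * x i)"
    by (simp add: assms(2))
  ultimately show ?case
    using assms(1) by (metis alternates.simps(2) mult_pos_pos)
qed

text \<open>Only the first entry of a chain can sit at index 0, and the gap below \<open>r\<close>
  is zero, so dropping the constant term costs at most one sign change.\<close>

lemma alternates_shift:
  assumes "r > 0" "\<And>j. 0 < j \<Longrightarrow> j < r \<Longrightarrow> x j = 0" "alternates x (Suc k) i s"
  shows "r \<le> i \<and> alternates (\<lambda>j. x (j + r)) k (i - r) s"
  using assms(3)
proof (induction k arbitrary: i s)
  case 0
  then have "0 < i" "x i \<noteq> 0"
    by auto
  then have "r \<le> i"
    using assms(2)[of i] by (cases "i < r") auto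
  then show ?case
    using 0 by auto
next
  case (Suc k)
  then obtain j where j: "j < i" "alternates x (Suc k) j (- s)" "0 < s * x i"
    by (auto simp del: alternates.simps(1))
  from Suc.IH[OF j(2)] have "r \<le> j" "alternates (\<lambda>j. x (j + r)) k (j - r) (- s)"
    by auto
  moreover have "j - r < i - r"
    using \<open>r \<le> j\<close> j(1) by simp
  ultimately show ?case
    using j by auto
qed

text \<open>With a vanishing constant term nothing is lost. This difference of one from
  \<open>alternates_shift\<close> is the whole gain of the iteration.\<close>

lemma alternates_shift_0:
  assumes "r > 0" "\<And>j. j < r \<Longrightarrow> x j = 0" "alternates x k i s"
  shows "r \<le> i \<and> alternates (\<lambda>j. x (j + r)) k (i - r) s"
  using assms(3)
proof (induction k arbitrary: i s)
  case 0
  then have "x i \<noteq> 0"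
    by auto
  then have "r \<le> i"
    using assms(2)[of i] by (cases "i < r") auto
  then show ?case
    using 0 by auto
next
  case (Suc k)
  then obtain j where j: "j < i" "alternates x k j (- s)" "0 < s * x i"
    by auto
  from Suc.IH[OF j(2)] have "r \<le> j" "alternates (\<lambda>j. x (j + r)) k (j - r) (- s)"
    by auto
  moreover have "j - r < i - r"
    using \<open>r \<le> j\<close> j(1) by simp
  ultimately show ?case
    using j by auto
qed

text \<open>For fixed indices a chain is a finite conjunction of strict inequalities, and each of
  them survives a small perturbation.\<close>

lemma alternates_tendsto:
  fixes x :: "'b \<Rightarrow> nat \<Rightarrow> real"
  assumes "\<And>j. ((\<lambda>c. x c j) \<longlongrightarrow> y j) F" "alternates y k i s"
  shows "eventually (\<lambda>c. alternates (x c) k i s) F"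
  using assms(2)
proof (induction k arbitrary: i s)
  case 0
  have "((\<lambda>c. s * x c i) \<longlongrightarrow> s * y i) F"
    by (intro tendsto_intros assms)
  then show ?case
    using 0 by (auto dest: order_tendstoD(1))
next
  case (Suc k)
  then obtain j where j: "j < i" "alternates y k j (- s)" "0 < s * y i"
    by auto
  have "((\<lambda>c. s * x c i) \<longlongrightarrow> s * y i) F"
    by (intro tendsto_intros assms)
  then have "eventually (\<lambda>c. 0 < s * x c i) F"
    using j by (auto dest: order_tendstoD(1))
  with Suc.IH[OF j(2)] show ?case
    by eventually_elim (use j in auto)
qed

context
  fixes x y :: "nat \<Rightarrow> real" and a :: real
  assumes a: "a > 0" and x0: "x 0 = y 0" and xS: "\<And>i. x (Suc i) = y (Suc i) - a * y i"
begin

text \<open>The recurrence reads \<open>y (Suc l) = x (Suc l) + a * y l\<close> with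
  \<open>a > 0\<close>, so \<open>y\<close> cannot acquire a sign that \<open>x\<close> has not yet
  shown.\<close>

lemma smoothing_sign_start:
  assumes "0 < s * y i"
  shows "\<exists>l\<le>i. 0 < s * x l"
proof (rule ccontr)
  assume "\<not> ?thesis"
  then have neg: "s * x l \<le> 0" if "l \<le> i" for l
    using that by force
  have "s * y l \<le> 0" if "l \<le> i" for l
    using that
  proof (induction l)
    case 0
    then show ?case using neg[of 0] x0 by simp
  next
    case (Suc l)
    have "s * y (Suc l) = s * x (Suc l) + a * (s * y l)"
      unfolding xS by (simp add: algebra_simps)
    moreover have "a * (s * y l) \<le> 0"
      using Suc a by (simp add: mult_le_0_iff)
    ultimately show ?case
      using neg[OF Suc.prems] by linarith
  qed
  then show False
    using assms by force
qed

text \<open>Once \<open>s * y\<close> is negative, the recurrence keeps it negative until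
  \<open>x\<close> pushes the other way. The inequality at \<open>i\<close> is weak so that a zero
  of \<open>y\<close> can serve as the end point, as in
  \<open>alternates_smoothing_strict\<close>.\<close>

lemma smoothing_sign_between:
  assumes "s * y j < 0" "0 \<le> s * y i" "j < i"
  shows "\<exists>l. j < l \<and> l \<le> i \<and> 0 < s * x l"
proof (rule ccontr)
  assume "\<not> ?thesis"
  then have neg: "s * x l \<le> 0" if "j < l" "l \<le> i" for l
    using that by force
  have "s * y (j + n) < 0" if "j + n \<le> i" for n
    using that
  proof (induction n)
    case 0
    then show ?case using assms by simp
  next
    case (Suc n)
    have "s * y (Suc (j + n)) = s * x (Suc (j + n)) + a * (s * y (j + n))"
      unfolding xS by (simp add: algebra_simps)
    moreover have "a * (s * y (j + n)) < 0"
      using Suc a by (simp add: mult_less_0_iff)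
    moreover have "s * x (Suc (j + n)) \<le> 0"
      using neg Suc.prems by simp
    ultimately show ?case
      by simp
  qed
  from this[of "i - j"] show False
    using assms by simp
qed

text \<open>Each sign change of \<open>y\<close> forces the new sign in \<open>x\<close> after the
  earlier of the two indices and not after the later one. Indices only move to the left, so the
  chain for \<open>x\<close> stays ordered.\<close>

lemma alternates_smoothing:
  assumes "alternates y k i s"
  shows "\<exists>i'\<le>i. alternates x k i' s"
  using assms
proof (induction k arbitrary: i s)
  case 0
  then show ?case using smoothing_sign_start by auto
next
  case (Suc k)
  then obtain j where j: "j < i" "alternates y k j (- s)" "0 < s * y i"
    by auto
  obtain j' where j': "j' \<le> j" "alternates x k j' (- s)"
    using Suc.IH[OF j(2)] by blast
  have "s * y j < 0"
    using alternates_last[OF j(2)] by simp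
  then obtain l where l: "j < l" "l \<le> i" "0 < s * x l"
    using smoothing_sign_between[of s j i] j by auto
  have "j' < l"
    using j' l by simp
  then show ?case
    using l j' by (intro exI[of _ l]) (auto intro!: exI[of _ j'])
qed

text \<open>The extra sign change of \<open>x\<close> offsets the one contributed by the constant term of
  \<open>1 - z t\<^sup>r h(t)\<close> in the proof of \<open>reciprocal_coeff_zero_imp_real\<close>.\<close>

lemma alternates_smoothing_strict:
  assumes "alternates y k i s" "i < m" "y m = 0"
  shows "\<exists>i'\<le>m. alternates x (Suc k) i' (- s)"
proof -
  obtain j' where j': "j' \<le> i" "alternates x k j' s"
    using alternates_smoothing[OF assms(1)] by blast
  have "(- s) * y i < 0"
    using alternates_last[OF assms(1)] by simp
  then obtain l where l: "i < l" "l \<le> m" "0 < (- s) * x l"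
    using smoothing_sign_between[of "- s" i m] assms by auto
  have "j' < l"
    using j' l by simp
  then show ?thesis
    using l j' by (intro exI[of _ l]) (auto intro!: exI[of _ j'])
qed

end

lemma fps_of_poly_lin [simp]:
  "fps_of_poly [:1, - a:] = 1 - fps_const (a::'a::comm_ring_1) * fps_X"
  by (intro fps_ext) (auto simp: coeff_pCons split: nat.splits)

lemma fps_lin_mult_nth:
  fixes Y :: "'a::comm_ring_1 fps"
  assumes "U = (1 - fps_const a * fps_X) * Y"
  shows "fps_nth U 0 = fps_nth Y 0" "fps_nth U (Suc i) = fps_nth Y (Suc i) - a * fps_nth Y i"
  unfolding assms by (simp_all add: left_diff_distrib mult.assoc)

lemma alternates_lin_prod:
  fixes X Y :: "real fps"
  assumes "\<forall>a\<in>set as. 0 < a" "fps_of_poly (lin_prod as) * Y = X" "alternates (fps_nth Y) k i s"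
  shows "\<exists>i'\<le>i. alternates (fps_nth X) k i' s"
  using assms
proof (induction as arbitrary: Y i)
  case Nil
  then show ?case by auto
next
  case (Cons a as)
  define U where "U = (1 - fps_const a * fps_X) * Y"
  obtain j where j: "j \<le> i" "alternates (fps_nth U) k j s"
    using alternates_smoothing[of a "fps_nth U" "fps_nth Y", OF _ fps_lin_mult_nth[OF U_def] Cons.prems(3)]
      Cons.prems(1) by auto
  have "fps_of_poly (lin_prod as) * U = X"
    using Cons.prems(2) by (simp add: U_def fps_of_poly_mult mult_ac del: mult_pCons_left mult_pCons_right)
  then show ?case
    using Cons.IH[OF _ _ j(2)] Cons.prems(1) j(1) by (meson dual_order.trans list.set_intros(2))
qed

text \<open>The zero at \<open>m\<close> is spent on a single factor, after which the sequence need
  not vanish at \<open>m\<close>; the remaining factors merely preserve the count.\<close>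

lemma alternates_lin_prod_strict:
  fixes X Y :: "real fps"
  assumes "\<forall>a\<in>set as. 0 < a" "as \<noteq> []" "fps_of_poly (lin_prod as) * Y = X"
    "alternates (fps_nth Y) k i s" "i \<le> m" "fps_nth Y m = 0"
  shows "\<exists>i'\<le>m. alternates (fps_nth X) (Suc k) i' (- s)"
proof -
  obtain a as' where as: "as = a # as'"
    using assms(2) by (cases as) auto
  define U where "U = (1 - fps_const a * fps_X) * Y"
  have "i \<noteq> m"
    using alternates_last[OF assms(4)] assms(6) by auto
  then obtain j where j: "j \<le> m" "alternates (fps_nth U) (Suc k) j (- s)"
    using alternates_smoothing_strict[of a "fps_nth U" "fps_nth Y", OF _ fps_lin_mult_nth[OF U_def] assms(4) _ assms(6)]
      assms(1,5) as by (auto simp del: alternates.simps)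
  have "fps_of_poly (lin_prod as') * U = X"
    using assms(3) by (simp add: as U_def fps_of_poly_mult mult_ac del: mult_pCons_left mult_pCons_right)
  then show ?thesis
    using alternates_lin_prod[OF _ _ j(2)] assms(1) as j(1)
    by (meson dual_order.trans list.set_intros(2))
qed

text \<open>By compactness two powers nearly agree in both components at once, and then their
  quotients are nearly 1. Two bases are treated together because comparing two frequencies needs
  common return times.\<close>

lemma unit_powers_return:
  fixes u v :: complex
  assumes "norm u = 1" "norm v = 1"
  obtains N where "filterlim N at_top sequentially"
    "(\<lambda>k. u ^ N k) \<longlonglongrightarrow> 1" "(\<lambda>k. v ^ N k) \<longlonglongrightarrow> 1"
proof -
  have "\<exists>N\<ge>k. norm (u ^ N - 1) < inverse (Suc k) \<and> norm (v ^ N - 1) < inverse (Suc k)" for k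
  proof -
    define e where "e = inverse (real (Suc k))"
    have "e > 0" by (simp add: e_def)
    have "compact (cball (0::complex) 1 \<times> cball (0::complex) 1)"
      by (intro compact_Times compact_cball)
    moreover have "\<forall>n. (u ^ n, v ^ n) \<in> cball 0 1 \<times> cball 0 1"
      using assms by (simp add: norm_power)
    ultimately obtain l \<sigma> where \<sigma>: "strict_mono (\<sigma> :: nat \<Rightarrow> nat)" "((\<lambda>n. (u ^ n, v ^ n)) \<circ> \<sigma>) \<longlonglongrightarrow> l"
      unfolding compact_def by meson
    then have "Cauchy ((\<lambda>n. (u ^ n, v ^ n)) \<circ> \<sigma>)"
      by (intro LIMSEQ_imp_Cauchy)
    then obtain M where M: "\<And>m n. m \<ge> M \<Longrightarrow> n \<ge> M \<Longrightarrow> dist (u ^ \<sigma> m, v ^ \<sigma> m) (u ^ \<sigma> n, v ^ \<sigma> n) < e"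
      using \<open>e > 0\<close> unfolding Cauchy_def comp_def by metis
    \<comment> \<open>The index \<open>M + \<sigma> M + k\<close> makes the exponent
      \<open>j - i\<close> at least \<open>k\<close>, so that the return times tend to
      infinity.\<close>
    define i j where "i = \<sigma> M" and "j = \<sigma> (M + \<sigma> M + k)"
    have ij: "i + k \<le> j"
      using seq_suble[OF \<sigma>(1), of "M + \<sigma> M + k"] by (simp add: i_def j_def)
    have d: "dist (u ^ j, v ^ j) (u ^ i, v ^ i) < e"
      unfolding i_def j_def by (rule M) auto
    have *: "norm (w ^ (j - i) - 1) = dist (w ^ j) (w ^ i)" if "norm w = 1" for w :: complex
    proof -
      have "w ^ j - w ^ i = w ^ i * (w ^ (j - i) - 1)"
        using ij by (simp add: algebra_simps flip: power_add)
      then show ?thesis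
        using that by (simp add: dist_norm norm_mult norm_power)
    qed
    have "dist (u ^ j) (u ^ i) < e" "dist (v ^ j) (v ^ i) < e"
      using d dist_fst_le[of "(u ^ j, v ^ j)" "(u ^ i, v ^ i)"] dist_snd_le[of "(u ^ j, v ^ j)" "(u ^ i, v ^ i)"]
      by auto
    then show ?thesis
      using *[OF assms(1)] *[OF assms(2)] ij by (intro exI[of _ "j - i"]) (simp add: e_def)
  qed
  then obtain N where N: "\<And>k. N k \<ge> k" "\<And>k. norm (u ^ N k - 1) < inverse (Suc k)"
    "\<And>k. norm (v ^ N k - 1) < inverse (Suc k)"
    by metis
  have "filterlim N at_top sequentially"
    using N(1) by (intro filterlim_at_top_mono[OF filterlim_ident]) auto
  moreover have "(\<lambda>k. u ^ N k) \<longlonglongrightarrow> 1" "(\<lambda>k. v ^ N k) \<longlonglongrightarrow> 1"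
    by (rule LIM_zero_cancel, rule tendsto_norm_zero_cancel, rule tendsto_sandwich[OF _ _ tendsto_const LIMSEQ_inverse_real_of_nat];
        use N in \<open>auto intro!: always_eventually less_imp_le\<close>)+
  ultimately show ?thesis
    using that by blast
qed

lemma alternates_eq_scale:
  assumes "\<rho> > 0" "\<And>j. y j = \<rho> * x j"
  shows "alternates y k i s \<longleftrightarrow> alternates x k i s"
proof
  assume "alternates y k i s"
  moreover have "x j = inverse \<rho> * y j" for j
    using assms by simp
  ultimately show "alternates x k i s"
    using alternates_scale[of "inverse \<rho>" x y] assms(1) by auto
qed (use alternates_scale assms in blast)

lemma reciprocal_coeff_zero_imp_real:
  fixes z :: complex and h :: "complex fps"
  assumes "\<forall>a\<in>set as. 0 < a" "as \<noteq> []" "c > 0" "r > 0"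
    and P: "P = smult c (lin_prod as)"
    and h: "h * (fps_of_poly (map_poly of_real P) + fps_const z * fps_X ^ r) = 1"
    and "fps_nth h m = 0"
  shows "Im z = 0"
proof (rule ccontr)
  assume z: "Im z \<noteq> 0"
  define v where "v w j = Re (w * fps_nth h j)" for w j
  define B where "B w k \<longleftrightarrow> (\<exists>i\<le>m. \<exists>s. alternates (v w) k i s)" for w k
  define Y where "Y w = Abs_fps (v w)" for w
  \<comment> \<open>The coefficients of \<open>1 - z t^r h\<close>, multiplied by \<open>w\<close>,
    in real part and divided by \<open>c\<close>: a constant term, a gap of zeros, then a shifted
    positive multiple of \<open>v (- w * z)\<close>.\<close>
  define x where "x w j = (if j = 0 then Re w else if j < r then 0 else Re (- w * z * fps_nth h (j - r))) / c" for w j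
  have X: "fps_of_poly (lin_prod as) * Y w = Abs_fps (x w)" for w
  proof (rule fps_ext)
    fix j
    have "fps_of_poly (map_poly of_real P) * h = 1 - fps_X ^ r * (fps_const z * h)"
      using h by (simp add: algebra_simps)
    then have "fps_nth (fps_of_poly (map_poly of_real P) * h) j = fps_nth (1 - fps_X ^ r * (fps_const z * h)) j"
      by simp
    also have "\<dots> = (if j = 0 then 1 else if j < r then 0 else - (z * fps_nth h (j - r)))"
      using assms(4) by (auto simp: fps_X_power_mult_nth)
    finally have 1: "fps_nth (fps_of_poly (map_poly of_real P) * h) j
        = (if j = 0 then 1 else if j < r then 0 else - (z * fps_nth h (j - r)))" .
    have "c * fps_nth (fps_of_poly (lin_prod as) * Y w) j = fps_nth (fps_of_poly P * Y w) j"
      by (simp add: P fps_of_poly_smult mult.assoc)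
    also have "\<dots> = Re (w * fps_nth (fps_of_poly (map_poly of_real P) * h) j)"
      unfolding fps_mult_nth Y_def v_def sum_distrib_left Re_sum
      by (intro sum.cong) (simp_all add: coeff_map_poly algebra_simps)
    also have "\<dots> = c * x w j"
      using assms(3) unfolding 1 by (simp add: x_def algebra_simps)
    finally show "fps_nth (fps_of_poly (lin_prod as) * Y w) j = fps_nth (Abs_fps (x w)) j"
      using assms(3) by simp
  qed
  have Yv: "fps_nth (Y w) = v w" for w
    by (simp add: Y_def fun_eq_iff)
  have Ym: "fps_nth (Y w) m = 0" for w
    using assms(7) by (simp add: Y_def v_def)
  have xshift: "v (- w * z) j = c * x w (j + r)" for w j
    using assms(3,4) by (simp add: v_def x_def)
  \<comment> \<open>Multiplying by the linear factors gains one change, because the sequence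
    \<open>v w\<close> ends in a zero at \<open>m\<close>.\<close>
  have step0: "\<exists>i\<le>m. \<exists>s. alternates (x w) (Suc k) i s" if "B w k" for w k
  proof -
    from that obtain i s where "i \<le> m" "alternates (fps_nth (Y w)) k i s"
      unfolding B_def Yv by blast
    then obtain i' where "i' \<le> m" "alternates (fps_nth (Abs_fps (x w))) (Suc k) i' (- s)"
      using alternates_lin_prod_strict[OF assms(1,2) X _ _ Ym] by blast
    moreover have "fps_nth (Abs_fps (x w)) = x w"
      by (simp add: fun_eq_iff)
    ultimately show ?thesis
      by (simp only:) blast
  qed
  have shift: "B (- w * z) k" if "i \<le> m" "r \<le> i" "alternates (\<lambda>j. x w (j + r)) k (i - r) s" for w k i s
    unfolding B_def
    using alternates_scale[OF assms(3) xshift that(3)] that(1,2) by (meson diff_le_self dual_order.trans)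
  have step: "B (- w * z) k" if Bw: "B w k" for w k
  proof -
    obtain i s where i: "i \<le> m" "alternates (x w) (Suc k) i s"
      using step0[OF Bw] by blast
    have "r \<le> i \<and> alternates (\<lambda>j. x w (j + r)) k (i - r) s"
      by (rule alternates_shift[OF assms(4) _ i(2)]) (simp add: x_def)
    then show ?thesis
      using shift i by blast
  qed
  \<comment> \<open>\<open>Re \<i> = 0\<close> removes the constant term of \<open>x \<i>\<close>,
    so the change gained in \<open>step0\<close> is kept.\<close>
  have step_strict: "B (- \<i> * z) (Suc k)" if Bw: "B \<i> k" for k
  proof -
    obtain i s where i: "i \<le> m" "alternates (x \<i>) (Suc k) i s"
      using step0[OF Bw] by blast
    have "r \<le> i \<and> alternates (\<lambda>j. x \<i> (j + r)) (Suc k) (i - r) s"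
      by (rule alternates_shift_0[OF assms(4) _ i(2)]) (simp add: x_def)
    then show ?thesis
      using shift i by blast
  qed
  have h0: "fps_nth h 0 = of_real (1 / c)"
  proof -
    have "fps_nth (h * (fps_of_poly (map_poly of_real P) + fps_const z * fps_X ^ r)) 0 = 1"
      using h by simp
    moreover have "coeff (lin_prod as) 0 = (1::real)" for as
      by (induction as) (auto simp: coeff_mult_0)
    ultimately show ?thesis
      using assms(3,4) by (simp add: P coeff_map_poly field_simps)
  qed
  \<comment> \<open>The claim is that some coefficient of \<open>h\<close> up to \<open>m\<close> is
    not real. If all were real, coefficient \<open>r\<close> would force \<open>Im z = 0\<close>; if
    \<open>m < r\<close>, then \<open>x 1\<close> vanishes at 1, ..., \<open>m\<close> and cannot
    have the change that \<open>step0\<close> produces.\<close>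
  have B0: "B \<i> 0"
  proof (rule ccontr)
    assume nB: "\<not> B \<i> 0"
    have im: "Im (fps_nth h j) = 0" if "j \<le> m" for j
    proof (rule ccontr)
      assume "Im (fps_nth h j) \<noteq> 0"
      then have "alternates (v \<i>) 0 j (v \<i> j)"
        by (auto simp: v_def zero_less_mult_iff)
      then show False
        using nB that unfolding B_def by blast
    qed
    show False
    proof (cases "r \<le> m")
      case True
      have "fps_nth (fps_of_poly (lin_prod as) * Y \<i>) r = x \<i> r"
        using X by simp
      moreover have "fps_nth (fps_of_poly (lin_prod as) * Y \<i>) r = 0"
        using im True by (auto simp: fps_mult_nth Y_def v_def intro!: sum.neutral)
      moreover have "x \<i> r = Im z / c / c"
        using assms(3,4) h0 by (simp add: x_def)
      ultimately show False
        using z assms(3) by simp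
    next
      case False
      have "alternates (v 1) 0 0 1"
        using h0 assms(3) by (simp add: v_def)
      then have "B 1 0"
        unfolding B_def by blast
      then obtain i s where i: "i \<le> m" "alternates (x 1) (Suc 0) i s"
        using step0 by blast
      then have "i \<noteq> 0" "x 1 i \<noteq> 0"
        by auto
      then show False
        using False i by (simp add: x_def)
    qed
  qed
  have znz: "z \<noteq> 0"
    using z by auto
  \<comment> \<open>Positive factors do not affect signs, so only the direction of
    \<open>- z\<close> matters and the iteration can take place on the unit circle.\<close>
  define u where "u = - z / norm z"
  have nu: "norm u = 1"
    using znz by (simp add: u_def norm_divide)
  have Bscale: "B (of_real \<rho> * w) k \<longleftrightarrow> B w k" if "\<rho> > 0" for \<rho> w k
  proof -
    have "v (of_real \<rho> * w) j = \<rho> * v w j" for j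
      by (simp add: v_def algebra_simps)
    then show ?thesis
      unfolding B_def using alternates_eq_scale[OF that, of "v (of_real \<rho> * w)" "v w"] by metis
  qed
  have stepu: "B (w * u) k" if Bw: "B w k" for w k
  proof -
    have "- w * z = of_real (norm z) * (w * u)"
      using znz by (simp add: u_def)
    then show ?thesis
      using step[OF Bw] Bscale[of "norm z" "w * u" k] znz by simp
  qed
  have stepu_strict: "B (\<i> * u) (Suc k)" if Bi: "B \<i> k" for k
  proof -
    have "- \<i> * z = of_real (norm z) * (\<i> * u)"
      using znz by (simp add: u_def)
    then show ?thesis
      using step_strict[OF Bi] Bscale[of "norm z" "\<i> * u" "Suc k"] znz by simp
  qed
  have iter: "B (w * u ^ n) k" if "B w k" for w n k
  proof (induction n)
    case (Suc n)
    then show ?case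
      using stepu[of "w * u ^ n"] by (simp add: mult_ac)
  qed (use that in simp)
  obtain N where N: "filterlim N at_top sequentially" "(\<lambda>k. (cnj u) ^ N k) \<longlonglongrightarrow> 1"
    using unit_powers_return[of "cnj u" "cnj u"] nu by auto
  have inc: "B \<i> (Suc k)" if Bi: "B \<i> k" for k
  proof -
    obtain i s where si: "i \<le> m" "alternates (v (\<i> * u)) (Suc k) i s"
      using stepu_strict[OF Bi] unfolding B_def by blast
    \<comment> \<open>The point near \<open>\<i> * u\<close> is taken to be
      \<open>\<i> * u * cnj u ^ N\<close>: from there exactly \<open>N - 1\<close> further
      multiplications by \<open>u\<close> lead back to \<open>\<i>\<close>.\<close>
    have lim: "(\<lambda>n. v (\<i> * u * cnj u ^ N n) j) \<longlonglongrightarrow> v (\<i> * u * 1) j" for j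
      unfolding v_def by (intro tendsto_intros N)
    have "eventually (\<lambda>n. alternates (v (\<i> * u * cnj u ^ N n)) (Suc k) i s) sequentially"
      by (rule alternates_tendsto[OF lim]) (use si in simp)
    moreover have "eventually (\<lambda>n. N n \<ge> 1) sequentially"
      using N(1) by (simp add: filterlim_at_top)
    ultimately have "eventually (\<lambda>n. alternates (v (\<i> * u * cnj u ^ N n)) (Suc k) i s \<and> N n \<ge> 1) sequentially"
      by eventually_elim auto
    then obtain n where n: "alternates (v (\<i> * u * cnj u ^ N n)) (Suc k) i s" "N n \<ge> 1"
      unfolding eventually_sequentially by blast
    have uu: "u * cnj u = 1"
      using nu by (simp add: complex_norm_square [symmetric])
    have "B (\<i> * u * cnj u ^ N n * u ^ (N n - 1)) (Suc k)"
      by (rule iter) (use n si in \<open>auto simp: B_def\<close>)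
    also have "\<i> * u * cnj u ^ N n * u ^ (N n - 1) = \<i> * (u * cnj u) ^ N n"
      using n(2) by (cases "N n") (auto simp: power_mult_distrib)
    finally show ?thesis
      by (simp add: uu)
  qed
  have "B \<i> k" for k
    by (induction k) (use B0 inc in auto)
  then obtain i s where "i \<le> m" "alternates (v \<i>) (Suc m) i s"
    unfolding B_def by blast
  then show False
    using alternates_le by fastforce
qed


subsection \<open>Positivity outside the interval\<close>

lemma fps_reciprocal_nonneg:
  fixes w y :: "real fps"
  assumes "w * y = 1" "fps_nth w 0 > 0" "\<And>i. i \<ge> 1 \<Longrightarrow> fps_nth w i \<le> 0"
  shows "fps_nth y n \<ge> 0"
proof (induction n rule: less_induct)
  case (less n)
  have eq: "(\<Sum>i=0..n. fps_nth w i * fps_nth y (n - i)) = (if n = 0 then 1 else 0)"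
    using arg_cong[OF assms(1), of "\<lambda>f. fps_nth f n"] by (simp add: fps_mult_nth)
  have "(\<Sum>i=0..n. fps_nth w i * fps_nth y (n - i))
      = fps_nth w 0 * fps_nth y n + (\<Sum>i=1..n. fps_nth w i * fps_nth y (n - i))"
    by (subst sum.atLeast_Suc_atMost) auto
  moreover have "(\<Sum>i=1..n. fps_nth w i * fps_nth y (n - i)) \<le> 0"
    using less assms(3) by (intro sum_nonpos mult_nonpos_nonneg) auto
  ultimately have "fps_nth w 0 * fps_nth y n \<ge> 0"
    using eq by (simp split: if_splits)
  then show ?case
    using assms(2) by (simp add: zero_le_mult_iff)
qed

text \<open>The strictly negative linear coefficient of \<open>w\<close> passes positivity from each
  coefficient of \<open>y\<close> to the next.\<close>

lemma fps_reciprocal_pos: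
  fixes w y :: "real fps"
  assumes "w * y = 1" "fps_nth w 0 > 0" "\<And>i. i \<ge> 1 \<Longrightarrow> fps_nth w i \<le> 0" "fps_nth w 1 < 0"
  shows "fps_nth y n > 0"
proof (induction n)
  case 0
  show ?case
    using arg_cong[OF assms(1), of "\<lambda>f. fps_nth f 0"] assms(2) by (metis fps_mult_nth_0 fps_one_nth zero_less_mult_pos zero_less_one)
next
  case (Suc n)
  have "0 = (\<Sum>i=0..Suc n. fps_nth w i * fps_nth y (Suc n - i))"
    using arg_cong[OF assms(1), of "\<lambda>f. fps_nth f (Suc n)"] by (simp add: fps_mult_nth)
  also have "\<dots> = fps_nth w 0 * fps_nth y (Suc n) + (fps_nth w 1 * fps_nth y n
      + (\<Sum>i=2..Suc n. fps_nth w i * fps_nth y (Suc n - i)))"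
  proof -
    have "{0..Suc n} = insert 0 (insert 1 {2..Suc n})"
      by auto
    then show ?thesis
      by simp
  qed
  finally have "fps_nth w 0 * fps_nth y (Suc n) = - (fps_nth w 1 * fps_nth y n)
      - (\<Sum>i=2..Suc n. fps_nth w i * fps_nth y (Suc n - i))"
    by simp
  moreover have "(\<Sum>i=2..Suc n. fps_nth w i * fps_nth y (Suc n - i)) \<le> 0"
    using fps_reciprocal_nonneg[OF assms(1-3)] assms(3) by (intro sum_nonpos mult_nonpos_nonneg) auto
  moreover have "fps_nth w 1 * fps_nth y n < 0"
    using Suc assms(4) by (simp add: mult_neg_pos)
  ultimately have "fps_nth w 0 * fps_nth y (Suc n) > 0"
    by linarith
  then show ?case
    using assms(2) by (simp add: zero_less_mult_iff)
qed

text \<open>Division by \<open>1 - X / s\<close> turns the partial sums at \<open>s\<close> into coefficients.\<close>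

lemma fps_reciprocal_pos_partial_sums:
  fixes q y :: "real fps"
  assumes "q * y = 1" "fps_nth q 0 > 0" "s > 0"
    and "\<And>i. i \<ge> 1 \<Longrightarrow> (\<Sum>j\<le>i. fps_nth q j * s ^ j) \<le> 0"
  shows "fps_nth y n > 0"
proof -
  define w where "w = Abs_fps (\<lambda>i. (\<Sum>j\<le>i. fps_nth q j * s ^ j) / s ^ i)"
  define y' where "y' = (1 - fps_const (1 / s) * fps_X) * y"
  have q: "q = w * (1 - fps_const (1 / s) * fps_X)"
  proof (rule fps_ext)
    fix n
    have "fps_nth w n - (if n = 0 then 0 else fps_nth w (n - 1) / s) = fps_nth q n"
      using assms(3) by (cases n) (auto simp: w_def field_simps)
    then show "fps_nth q n = fps_nth (w * (1 - fps_const (1 / s) * fps_X)) n"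
      by (cases n) (simp_all add: algebra_simps)
  qed
  have "w * y' = 1"
    using assms(1) by (simp add: q y'_def mult_ac)
  moreover have "fps_nth w 0 > 0"
    using assms(2) by (simp add: w_def)
  moreover have "fps_nth w i \<le> 0" if "i \<ge> 1" for i
    using assms(4)[OF that] assms(3) by (simp add: w_def divide_nonpos_pos)
  ultimately have y': "fps_nth y' n \<ge> 0" for n
    using fps_reciprocal_nonneg by blast
  show ?thesis
  proof (induction n)
    case 0
    show ?case
      using arg_cong[OF assms(1), of "\<lambda>f. fps_nth f 0"] assms(2) by (metis fps_mult_nth_0 fps_one_nth zero_less_mult_pos zero_less_one)
  next
    case (Suc n)
    have "fps_nth y (Suc n) = fps_nth y' (Suc n) + fps_nth y n / s"
      using fps_lin_mult_nth(2)[OF y'_def] by simp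
    then show ?case
      using Suc y'[of "Suc n"] assms(3) by (simp add: add_nonneg_pos)
  qed
qed

lemma lin_prod_reciprocal_nonneg:
  fixes X Y :: "real fps"
  assumes "\<forall>b\<in>set bs. 0 \<le> b" "fps_of_poly (lin_prod bs) * Y = X" "\<And>i. fps_nth X i \<ge> 0"
  shows "fps_nth Y n \<ge> 0"
  using assms(1,2)
proof (induction bs arbitrary: Y n)
  case Nil
  then show ?case using assms(3) by auto
next
  case (Cons b bs)
  define U where "U = (1 - fps_const b * fps_X) * Y"
  have "fps_of_poly (lin_prod bs) * U = X"
    using Cons.prems(2)
    by (simp add: U_def fps_of_poly_mult mult_ac del: mult_pCons_left mult_pCons_right)
  then have U: "fps_nth U i \<ge> 0" for i
    using Cons by simp
  show ?case
  proof (induction n)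
    case 0
    then show ?case
      using U[of 0] fps_lin_mult_nth(1)[OF U_def] by simp
  next
    case (Suc n)
    then have "0 \<le> b * fps_nth Y n"
      using Cons.prems(1) by simp
    then show ?case
      using U[of "Suc n"] fps_lin_mult_nth(2)[OF U_def, of n] by linarith
  qed
qed

text \<open>Division by \<open>1 - b X\<close> multiplies the value at \<open>s\<close> by
  \<open>1 / (1 - b * s)\<close>. As all coefficients are nonnegative, truncation only lowers the
  value, so the bound holds for each partial sum.\<close>

lemma lin_prod_reciprocal_partial_sums:
  fixes X Y :: "real fps"
  assumes "\<forall>b\<in>set bs. 0 \<le> b \<and> b * s < 1" "s > 0" "fps_of_poly (lin_prod bs) * Y = X"
    "\<And>i. fps_nth X i \<ge> 0" "\<And>i. (\<Sum>j\<le>i. fps_nth X j * s ^ j) \<le> K"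
  shows "(\<Sum>j\<le>i. fps_nth Y j * s ^ j) \<le> K / poly (lin_prod bs) s"
  using assms(1,3)
proof (induction bs arbitrary: Y i)
  case Nil
  then show ?case using assms(5) by auto
next
  case (Cons b bs)
  define U where "U = (1 - fps_const b * fps_X) * Y"
  have U: "fps_of_poly (lin_prod bs) * U = X"
    using Cons.prems(2)
    by (simp add: U_def fps_of_poly_mult mult_ac del: mult_pCons_left mult_pCons_right)
  have IH: "(\<Sum>j\<le>i. fps_nth U j * s ^ j) \<le> K / poly (lin_prod bs) s" for i
    using Cons.IH[OF _ U] Cons.prems(1) by simp
  have Y: "fps_nth Y n \<ge> 0" for n
    using lin_prod_reciprocal_nonneg[OF _ Cons.prems(2) assms(4)] Cons.prems(1) by blast
  have bs: "0 \<le> b" "b * s < 1"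
    using Cons.prems(1) by auto
  have split: "(\<Sum>j\<le>n. fps_nth Y j * s ^ j) = (\<Sum>j\<le>n. fps_nth U j * s ^ j) + b * s * (\<Sum>j<n. fps_nth Y j * s ^ j)" for n
  proof (induction n)
    case 0
    then show ?case
      using fps_lin_mult_nth(1)[OF U_def] by simp
  next
    case (Suc n)
    have "(\<Sum>j\<le>Suc n. fps_nth Y j * s ^ j) = (\<Sum>j\<le>n. fps_nth U j * s ^ j)
        + b * s * (\<Sum>j<n. fps_nth Y j * s ^ j) + (fps_nth U (Suc n) + b * fps_nth Y n) * s ^ Suc n"
      using Suc.IH fps_lin_mult_nth(2)[OF U_def, of n] by simp
    also have "\<dots> = (\<Sum>j\<le>Suc n. fps_nth U j * s ^ j)
        + b * s * ((\<Sum>j<n. fps_nth Y j * s ^ j) + fps_nth Y n * s ^ n)"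
      by (simp add: algebra_simps)
    finally show ?case
      by simp
  qed
  have "(\<Sum>j<i. fps_nth Y j * s ^ j) \<le> (\<Sum>j\<le>i. fps_nth Y j * s ^ j)"
    using Y assms(2) by (intro sum_mono2) auto
  then have "b * s * (\<Sum>j<i. fps_nth Y j * s ^ j) \<le> b * s * (\<Sum>j\<le>i. fps_nth Y j * s ^ j)"
    using bs assms(2) by (intro mult_left_mono) auto
  then have "(1 - b * s) * (\<Sum>j\<le>i. fps_nth Y j * s ^ j) \<le> (\<Sum>j\<le>i. fps_nth U j * s ^ j)"
    using split[of i] by (simp add: algebra_simps)
  also have "\<dots> \<le> K / poly (lin_prod bs) s"
    by (rule IH)
  finally have "(\<Sum>j\<le>i. fps_nth Y j * s ^ j) \<le> K / poly (lin_prod bs) s / (1 - b * s)"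
    using bs by (subst pos_le_divide_eq) (auto simp: mult.commute[of _ "1 - b * s"])
  moreover have "poly (lin_prod (b # bs)) s = poly (lin_prod bs) s * (1 - b * s)"
    by (simp add: algebra_simps)
  ultimately show ?case
    by simp
qed

lemma coeff_lin_prod_0 [simp]: "coeff (lin_prod as) 0 = 1"
  by (induction as) (auto simp: coeff_mult_0)

lemma coeff_lin_prod_alternating:
  fixes as :: "real list"
  assumes "\<forall>a\<in>set as. 0 < a"
  shows "(- 1) ^ i * coeff (lin_prod as) i \<ge> 0"
    and "i \<le> length as \<Longrightarrow> (- 1) ^ i * coeff (lin_prod as) i > 0"
proof -
  have "(- 1) ^ i * coeff (lin_prod as) i \<ge> 0 \<and> (i \<le> length as \<longrightarrow> (- 1) ^ i * coeff (lin_prod as) i > 0)"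
    using assms
  proof (induction as arbitrary: i)
    case Nil
    then show ?case by (auto simp: coeff_1)
  next
    case (Cons a as)
    show ?case
    proof (cases i)
      case 0
      then show ?thesis by (simp add: coeff_mult_0)
    next
      case (Suc j)
      have eq: "(- 1) ^ i * coeff (lin_prod (a # as)) i
          = (- 1) ^ i * coeff (lin_prod as) i + a * ((- 1) ^ j * coeff (lin_prod as) j)"
        by (simp add: Suc algebra_simps)
      have "(- 1) ^ i * coeff (lin_prod as) i \<ge> 0" "(- 1) ^ j * coeff (lin_prod as) j \<ge> 0"
        "j \<le> length as \<Longrightarrow> (- 1) ^ j * coeff (lin_prod as) j > 0"
        using Cons by auto
      moreover have "a > 0"
        using Cons.prems by simp
      moreover have "j \<le> length as" if "i \<le> length (a # as)"
        using that Suc by simp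
      ultimately show ?thesis
        unfolding eq by (meson add_nonneg_nonneg add_nonneg_pos mult_nonneg_nonneg mult_pos_pos less_imp_le)
    qed
  qed
  then show "(- 1) ^ i * coeff (lin_prod as) i \<ge> 0"
    "i \<le> length as \<Longrightarrow> (- 1) ^ i * coeff (lin_prod as) i > 0"
    by auto
qed

text \<open>Factoring out the product \<open>L\<close> over \<open>bs\<close> gives
  \<open>P + z t^r = c L q\<close> with \<open>q = 1 - \<alpha> X + (z / c) X^r F\<close>, where
  \<open>F = 1 / L\<close> has nonnegative coefficients. For \<open>z \<le> 0\<close> all
  coefficients of \<open>q\<close> beyond the constant one are nonpositive. For \<open>z > 0\<close>
  the partial sums of \<open>q\<close> at \<open>s\<close> are bounded by the total
  \<open>(P(s) + z s^r) / (c L(s)) \<le> 0\<close>.\<close>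

lemma reciprocal_coeff_pos_lower:
  fixes h :: "real fps"
  assumes "c > 0" "\<alpha> > 0" "\<forall>b\<in>set bs. 0 < b" "r > 0"
    and P: "P = smult c (lin_prod (\<alpha> # bs))"
    and h: "h * (fps_of_poly P + fps_const z * fps_X ^ r) = 1"
    and z: "z \<le> 0 \<or> (0 < z \<and> s > 0 \<and> (\<forall>b\<in>set bs. b * s < 1) \<and> poly P s + z * s ^ r \<le> 0)"
  shows "fps_nth h n > 0"
proof -
  define L where "L = fps_of_poly (lin_prod bs)"
  define F where "F = inverse L"
  have LF: "L * F = 1"
    unfolding F_def by (rule inverse_mult_eq_1') (simp add: L_def)
  have F: "fps_nth F i \<ge> 0" for i
    by (rule lin_prod_reciprocal_nonneg[OF _ LF[unfolded L_def]]) (use assms(3) in \<open>auto intro: less_imp_le\<close>)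
  have F0: "fps_nth F 0 = 1"
    by (simp add: F_def L_def)
  define q where "q = 1 - fps_const \<alpha> * fps_X + fps_const (z / c) * (fps_X ^ r * F)"
  define y where "y = fps_const c * (L * h)"
  have PL: "fps_of_poly P = fps_const c * ((1 - fps_const \<alpha> * fps_X) * L)"
    by (simp add: P L_def fps_of_poly_smult fps_of_poly_mult del: mult_pCons_left)
  have "fps_const c * (L * q) = fps_of_poly P + fps_const z * fps_X ^ r"
  proof -
    have "fps_const c * (L * q) = fps_of_poly P + (fps_const c * fps_const (z / c)) * fps_X ^ r * (L * F)"
      by (simp add: q_def PL algebra_simps del: fps_const_mult)
    then show ?thesis
      using assms(1) by (simp add: LF)
  qed
  moreover have "q * y = h * (fps_const c * (L * q))"
    by (simp only: y_def mult_ac)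
  ultimately have qy: "q * y = 1"
    using h by simp
  have qn: "fps_nth q i = (if i = 0 then 1 else if i = 1 then - \<alpha> else 0) + (if i < r then 0 else z / c * fps_nth F (i - r))" for i
    unfolding q_def by (cases i) (auto simp: fps_X_power_mult_nth)
  have y: "fps_nth y i > 0" for i
  proof (cases "z \<le> 0")
    case True
    then have "z / c * fps_nth F j \<le> 0" for j
      using F assms(1) by (intro mult_nonpos_nonneg) (auto simp: divide_nonpos_pos)
    then have le: "(if i < r then 0 else z / c * fps_nth F (i - r)) \<le> 0" for i
      by auto
    show ?thesis
    proof (rule fps_reciprocal_pos[OF qy])
      show "fps_nth q 0 > 0"
        using assms(4) by (simp add: qn)
      show "fps_nth q 1 < 0"
        unfolding qn using le[of 1] assms(2) by (intro add_neg_nonpos) auto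
      show "fps_nth q i \<le> 0" if "i \<ge> 1" for i
        unfolding qn using le[of i] assms(2) that by (intro add_nonpos_nonpos) auto
    qed
  next
    case False
    then have z: "z > 0" and s: "s > 0" "\<forall>b\<in>set bs. b * s < 1" "poly P s + z * s ^ r \<le> 0"
      using z by auto
    have Lpos: "poly (lin_prod bs) s > 0"
      using s(2) by (induction bs) (auto simp: mult.commute[of s] simp del: mult_pCons_left)
    have tot: "1 - \<alpha> * s + z / c * (s ^ r * (1 / poly (lin_prod bs) s)) \<le> 0"
    proof -
      have "poly P s = c * ((1 - \<alpha> * s) * poly (lin_prod bs) s)"
        by (simp add: P mult.commute[of s] del: mult_pCons_left)
      then have "c * poly (lin_prod bs) s * (1 - \<alpha> * s + z / c * (s ^ r * (1 / poly (lin_prod bs) s))) = poly P s + z * s ^ r"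
        using Lpos assms(1) by (simp add: divide_simps)
      then show ?thesis
        using s(3) mult_pos_pos[OF assms(1) Lpos] by (smt (verit) mult_pos_pos)
    qed
    show ?thesis
    proof (rule fps_reciprocal_pos_partial_sums[OF qy _ s(1)])
      show "fps_nth q 0 > 0"
        using assms(4) by (simp add: qn)
    next
      fix i :: nat
      assume i: "i \<ge> 1"
      \<comment> \<open>From index 1 on, a partial sum contains \<open>1 - \<alpha> * s\<close> in
        full. Only the nonnegative tail is truncated, and extending it to \<open>i + r\<close> lines
        it up with the series \<open>F\<close>.\<close>
      have "(\<Sum>j\<le>i. fps_nth q j * s ^ j) = (\<Sum>j\<le>i. (if j = 0 then 1 else if j = 1 then - \<alpha> else 0) * s ^ j)
          + (\<Sum>j\<le>i. (if j < r then 0 else z / c * fps_nth F (j - r)) * s ^ j)"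
        by (simp add: qn distrib_right sum.distrib)
      also have "(\<Sum>j\<le>i. (if j = 0 then 1 else if j = 1 then - \<alpha> else 0) * s ^ j) = (\<Sum>j\<in>{0,1}. (if j = 0 then 1 else if j = 1 then - \<alpha> else 0) * s ^ j)"
        using i by (intro sum.mono_neutral_right) auto
      also have "\<dots> = 1 - \<alpha> * s"
        by simp
      also have "(\<Sum>j\<le>i. (if j < r then 0 else z / c * fps_nth F (j - r)) * s ^ j)
          \<le> (\<Sum>j\<le>i+r. (if j < r then 0 else z / c * fps_nth F (j - r)) * s ^ j)"
        using z F s assms(1) by (intro sum_mono2) auto
      also have "\<dots> = (\<Sum>j\<in>{r..i+r}. (if j < r then 0 else z / c * fps_nth F (j - r)) * s ^ j)"
        by (intro sum.mono_neutral_right) auto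
      also have "\<dots> = (\<Sum>j\<le>i. z / c * (s ^ r * (fps_nth F j * s ^ j)))"
      proof (rule sum.reindex_bij_witness[of _ "\<lambda>j. j + r" "\<lambda>j. j - r"])
        fix j assume "j \<in> {r..i + r}"
        then have "s ^ j = s ^ r * s ^ (j - r)"
          by (simp flip: power_add)
        then show "z / c * (s ^ r * (fps_nth F (j - r) * s ^ (j - r)))
            = (if j < r then 0 else z / c * fps_nth F (j - r)) * s ^ j"
          using \<open>j \<in> {r..i + r}\<close> by simp
      qed auto
      also have "\<dots> = z / c * (s ^ r * (\<Sum>j\<le>i. fps_nth F j * s ^ j))"
        by (simp only: sum_distrib_left)
      also have "\<dots> \<le> z / c * (s ^ r * (1 / poly (lin_prod bs) s))"
      proof (intro mult_left_mono)
        show "(\<Sum>j\<le>i. fps_nth F j * s ^ j) \<le> 1 / poly (lin_prod bs) s"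
        proof (rule lin_prod_reciprocal_partial_sums[OF _ s(1) LF[unfolded L_def]])
          fix i
          have "(\<Sum>j\<le>i. fps_nth 1 j * s ^ j) = (\<Sum>j\<in>{0}. fps_nth 1 j * s ^ j)"
            by (rule sum.mono_neutral_right) auto
          then show "(\<Sum>j\<le>i. fps_nth 1 j * s ^ j) \<le> 1"
            by simp
        qed (use s assms(3) in \<open>auto intro: less_imp_le\<close>)
      qed (use z s assms(1) in auto)
      finally show "(\<Sum>j\<le>i. fps_nth q j * s ^ j) \<le> 0"
        using tot by linarith
    qed
  qed
  \<comment> \<open>Thus \<open>h = F * y / c\<close>, and the term \<open>F_0 y_n\<close> with
    \<open>F_0 = 1\<close> already makes the convolution strictly positive.\<close>
  have "F * y = fps_const c * h * (L * F)"
    by (simp only: y_def mult_ac)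
  then have "fps_const c * h = F * y"
    by (simp add: LF)
  from arg_cong[OF this, of "\<lambda>f. fps_nth f n"]
  have "c * fps_nth h n = (\<Sum>i=0..n. fps_nth F i * fps_nth y (n - i))"
    by (simp only: fps_mult_left_const_nth fps_mult_nth[of F y])
  also have "\<dots> > 0"
    using F F0 y by (intro sum_pos2[of _ 0]) (auto intro!: mult_nonneg_nonneg less_imp_le[OF y])
  finally show ?thesis
    using assms(1) by (simp add: zero_less_mult_iff)
qed

text \<open>Replacing \<open>t\<close> by \<open>- t\<close> makes the coefficients of
  \<open>P\<close> nonnegative, and \<open>z\<close> enters only as \<open>- z\<close> in degree 1,
  so every partial sum at \<open>s\<close> from index 1 on is at most
  \<open>P(-s) - z s\<close>.\<close>

lemma reciprocal_coeff_pos_upper: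
  fixes h :: "real fps"
  assumes "c > 0" "\<forall>a\<in>set as. 0 < a"
    and P: "P = smult c (lin_prod as)"
    and h: "h * (fps_of_poly P + fps_const z * fps_X) = 1"
    and s: "s > 0" "poly P (- s) \<le> z * s"
  shows "(- 1) ^ n * fps_nth h n > 0"
proof -
  define p where "p i = (- 1) ^ i * coeff P i" for i
  have p: "p i \<ge> 0" for i
    using coeff_lin_prod_alternating(1)[OF assms(2), of i] assms(1)
    by (simp add: p_def P mult.left_commute)
  have p0: "p 0 > 0"
    using assms(1) by (simp add: p_def P)
  define q where "q = Abs_fps (\<lambda>i. p i - (if i = 1 then z else 0))"
  define y where "y = Abs_fps (\<lambda>i. (- 1) ^ i * fps_nth h i)"
  have qy: "q * y = 1"
  proof (rule fps_ext)
    fix n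
    have "fps_nth (q * y) n = (\<Sum>i=0..n. (- 1) ^ n * (fps_nth (fps_of_poly P + fps_const z * fps_X) i * fps_nth h (n - i)))"
      unfolding fps_mult_nth
    proof (intro sum.cong refl)
      fix i assume "i \<in> {0..n}"
      then have e: "(- 1) ^ n = (- 1) ^ i * (- 1 :: real) ^ (n - i)"
        by (simp flip: power_add)
      show "fps_nth q i * fps_nth y (n - i) = (- 1) ^ n * (fps_nth (fps_of_poly P + fps_const z * fps_X) i * fps_nth h (n - i))"
        unfolding e by (auto simp: q_def y_def p_def algebra_simps)
    qed
    also have "\<dots> = (- 1) ^ n * fps_nth ((fps_of_poly P + fps_const z * fps_X) * h) n"
      by (simp only: fps_mult_nth[of "fps_of_poly P + fps_const z * fps_X"] sum_distrib_left)
    also have "\<dots> = fps_nth 1 n"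
      using h by (simp add: mult.commute)
    finally show "fps_nth (q * y) n = fps_nth 1 n" .
  qed
  have "fps_nth y n > 0"
  proof (rule fps_reciprocal_pos_partial_sums[OF qy _ s(1)])
    show "fps_nth q 0 > 0"
      using p0 by (simp add: q_def)
  next
    fix i :: nat
    assume i: "i \<ge> 1"
    have "(\<Sum>j\<le>i. fps_nth q j * s ^ j) = (\<Sum>j\<le>i. p j * s ^ j - (if j = 1 then z * s else 0))"
      by (intro sum.cong) (auto simp: q_def left_diff_distrib)
    also have "\<dots> = (\<Sum>j\<le>i. p j * s ^ j) - (\<Sum>j\<le>i. if j = 1 then z * s else 0)"
      by (rule sum_subtractf)
    also have "(\<Sum>j\<le>i. if j = 1 then z * s else 0) = z * s"
      using i by simp
    also have "(\<Sum>j\<le>i. p j * s ^ j) \<le> (\<Sum>j\<le>i + degree P. p j * s ^ j)"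
      using p s(1) by (intro sum_mono2) auto
    also have "\<dots> = (\<Sum>j\<le>degree P. p j * s ^ j)"
      by (rule sum.mono_neutral_right) (auto simp: p_def coeff_eq_0)
    also have "\<dots> = poly P (- s)"
      by (simp add: poly_altdef p_def power_minus[of s] mult_ac)
    finally show "(\<Sum>j\<le>i. fps_nth q j * s ^ j) \<le> 0"
      using s(2) by linarith
  qed
  then show ?thesis
    by (simp add: y_def)
qed


section \<open>Logarithmic derivatives of products of linear factors\<close>

lemma poly_lin_prod: "poly (lin_prod as) t = (\<Prod>a\<leftarrow>as. 1 - a * t)"
  by (induction as) (auto simp: algebra_simps)

lemma pderiv_lin_prod:
  fixes t :: "'a::field_char_0"
  assumes "\<forall>a\<in>set as. a * t \<noteq> 1"
  shows "t * poly (pderiv (lin_prod as)) t = poly (lin_prod as) t * (\<Sum>a\<leftarrow>as. a * t / (a * t - 1))"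
  using assms
proof (induction as)
  case (Cons a as)
  have at: "a * t - 1 \<noteq> 0"
    using Cons.prems by simp
  have "pderiv (lin_prod (a # as)) = [:1, - a:] * pderiv (lin_prod as) + lin_prod as * [:- a:]"
    by (simp only: lin_prod_simps pderiv_mult) (simp add: pderiv_pCons)
  then have "t * poly (pderiv (lin_prod (a # as))) t
      = (1 - a * t) * (t * poly (pderiv (lin_prod as)) t) - a * t * poly (lin_prod as) t"
    by (simp add: algebra_simps del: mult_pCons_left mult_pCons_right lin_prod_simps)
  also have "t * poly (pderiv (lin_prod as)) t = poly (lin_prod as) t * (\<Sum>a\<leftarrow>as. a * t / (a * t - 1))"
    using Cons by simp
  also have "(1 - a * t) * (poly (lin_prod as) t * (\<Sum>a\<leftarrow>as. a * t / (a * t - 1))) - a * t * poly (lin_prod as) t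
      = (1 - a * t) * poly (lin_prod as) t * (a * t / (a * t - 1) + (\<Sum>a\<leftarrow>as. a * t / (a * t - 1)))"
    using at by (simp add: divide_simps) (simp add: algebra_simps)
  finally show ?case
    by (simp add: algebra_simps)
qed simp

text \<open>Each summand is \<open>1 + 1 / (a * t - 1)\<close>, decreasing on either side of its
  pole; the hypothesis keeps every pole outside the interval from \<open>u\<close> to
  \<open>v\<close>.\<close>

lemma sum_list_log_deriv_antimono:
  fixes u v :: real
  assumes "u \<le> v" "\<forall>a\<in>set as. 0 < a \<and> (a * v < 1 \<or> 1 < a * u)"
  shows "(\<Sum>a\<leftarrow>as. a * v / (a * v - 1)) \<le> (\<Sum>a\<leftarrow>as. a * u / (a * u - 1))"
proof (rule sum_list_mono)
  fix a assume "a \<in> set as"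
  then have a: "0 < a" "a * v < 1 \<or> 1 < a * u"
    using assms(2) by auto
  have uv: "a * u \<le> a * v"
    using a(1) assms(1) by simp
  have "1 / (a * v - 1) \<le> 1 / (a * u - 1)"
    using a(2)
  proof
    assume "a * v < 1"
    then show ?thesis
      using uv by (simp add: divide_simps)
  next
    assume "1 < a * u"
    then show ?thesis
      using uv by (simp add: frac_le)
  qed
  moreover have "a * w / (a * w - 1) = 1 + 1 / (a * w - 1)" if "a * w \<noteq> 1" for w
    using that by (simp add: field_simps)
  ultimately show "a * v / (a * v - 1) \<le> a * u / (a * u - 1)"
    using a(2) uv by auto
qed

subsection \<open>The endpoints\<close>

text \<open>\<open>1 / \<alpha>\<close> is the smallest zero of \<open>P\<close>; \<open>bs\<close> lists the reciprocals of the
  remaining zeros, with multiplicity.\<close>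

locale positive_zeros =
  fixes c \<alpha> :: real and bs :: "real list" and r :: nat
  assumes c_pos: "c > 0" and \<alpha>_pos: "\<alpha> > 0" and bs: "\<forall>b\<in>set bs. 0 < b \<and> b \<le> \<alpha>"
    and r_pos: "r > 0" and nondegenerate: "r > 1 \<or> bs \<noteq> []"
begin

definition P :: "real poly" where "P = smult c (lin_prod (\<alpha> # bs))"

text \<open>The parameter \<open>z\<close> for which a nonzero \<open>t\<close> is a root of
  \<open>P(t) + z t^r\<close>.\<close>

definition \<zeta> :: "real \<Rightarrow> real" where "\<zeta> t = - poly P t / t ^ r"

text \<open>This is \<open>t P'(t) / P(t)\<close> away from the zeros of \<open>P\<close>. The
  nonzero critical points of \<open>\<zeta>\<close> there are the solutions of
  \<open>T t = r\<close>, and \<open>T\<close> is a sum of monotone terms.\<close>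

definition T :: "real \<Rightarrow> real" where "T t = (\<Sum>a\<leftarrow>\<alpha> # bs. a * t / (a * t - 1))"

lemma as_pos: "\<forall>a\<in>set (\<alpha> # bs). 0 < a"
  using \<alpha>_pos bs by simp

lemma poly_P: "poly P t = c * (\<Prod>a\<leftarrow>\<alpha> # bs. 1 - a * t)"
  by (simp add: P_def poly_lin_prod algebra_simps)

lemma poly_P_eq_0_iff: "poly P t = 0 \<longleftrightarrow> (\<exists>a\<in>set (\<alpha> # bs). a * t = 1)"
  using c_pos by (auto simp: poly_P prod_list_zero_iff)

lemma poly_P_0: "poly P 0 = c"
  by (simp add: poly_P map_replicate_const)

lemma R_poly: "t * poly (R_poly P r) t = t ^ r * (real r * poly P t - t * poly (pderiv P) t)"
proof -
  have "t ^ r = t * t ^ (r - 1)"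
    using r_pos by (cases r) auto
  then show ?thesis
    unfolding R_poly_def by (simp only: poly_diff poly_smult poly_mult poly_monom) (simp add: algebra_simps)
qed

lemma R_poly_T:
  assumes "\<forall>a\<in>set (\<alpha> # bs). a * t \<noteq> 1"
  shows "t * poly (R_poly P r) t = t ^ r * poly P t * (real r - T t)"
proof -
  have "t * poly (pderiv P) t = poly P t * T t"
    using pderiv_lin_prod[OF assms] by (simp add: P_def pderiv_smult T_def del: lin_prod_simps)
  then show ?thesis
    unfolding R_poly by (simp add: algebra_simps)
qed

lemma finite_R_poly_zeros: "finite {t. Q t \<and> poly (R_poly P r) t = 0}"
  by (rule finite_subset[OF _ poly_roots_finite[OF R_poly_nonzero[OF r_pos]]])
     (use poly_P_0 c_pos in auto)

lemma \<zeta>_deriv: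
  assumes "t \<noteq> 0"
  shows "(\<zeta> has_field_derivative poly (R_poly P r) t / t ^ (2 * r)) (at t)"
proof -
  have "\<zeta> field_differentiable at t"
    unfolding \<zeta>_def [abs_def] using assms by (auto intro!: derivative_intros simp: field_differentiable_def)
       (rule exI, (rule derivative_eq_intros poly_DERIV refl | simp)+)
  then have "(\<zeta> has_field_derivative deriv \<zeta> t) (at t)"
    by (rule field_differentiable_derivI)
  moreover have "poly (R_poly P r) t = t ^ (2 * r) * deriv \<zeta> t"
    unfolding \<zeta>_def [abs_def] by (rule R_poly_eq_deriv[OF assms])
  ultimately show ?thesis
    using assms by simp
qed

lemma \<zeta>_deriv_nonneg:
  assumes "t \<noteq> 0" "poly (R_poly P r) t \<ge> 0"
  shows "\<exists>y. (\<zeta> has_field_derivative y) (at t) \<and> 0 \<le> y"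
  using \<zeta>_deriv[OF assms(1)] assms(2)
  by (intro exI[of _ "poly (R_poly P r) t / t ^ (2 * r)"]) auto

lemma \<zeta>_deriv_nonpos:
  assumes "t \<noteq> 0" "poly (R_poly P r) t \<le> 0"
  shows "\<exists>y. (\<zeta> has_field_derivative y) (at t) \<and> y \<le> 0"
  using \<zeta>_deriv[OF assms(1)] assms(2)
  by (intro exI[of _ "poly (R_poly P r) t / t ^ (2 * r)"]) (auto intro: divide_nonpos_nonneg)

text \<open>Below the smallest zero of \<open>P\<close> no summand of \<open>T\<close> is positive
  and that of \<open>\<alpha>\<close> is negative, so \<open>T t < 0 < r\<close>.\<close>

lemma R_poly_pos_below:
  assumes "0 < t" "\<alpha> * t < 1"
  shows "poly (R_poly P r) t \<noteq> 0"
proof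
  assume "poly (R_poly P r) t = 0"
  have lt: "a * t < 1" if "a \<in> set (\<alpha> # bs)" for a
    using that bs assms by (auto intro: order.strict_trans1[OF mult_right_mono])
  have "a * t / (a * t - 1) \<le> 0" if "a \<in> set bs" for a
    using lt[of a] that bs assms(1) by (intro divide_nonneg_nonpos) auto
  then have "(\<Sum>a\<leftarrow>bs. a * t / (a * t - 1)) \<le> 0"
    by (induction bs) (auto intro: add_nonpos_nonpos)
  moreover have "\<alpha> * t / (\<alpha> * t - 1) < 0"
    using assms \<alpha>_pos by (simp add: divide_pos_neg)
  ultimately have "T t < 0"
    by (simp add: T_def)
  have ne: "\<forall>a\<in>set (\<alpha> # bs). a * t \<noteq> 1"
    using lt by force
  have "t ^ r * poly P t * (real r - T t) = 0"
    using R_poly_T[OF ne] \<open>poly (R_poly P r) t = 0\<close> by simp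
  moreover have "poly P t \<noteq> 0"
    using poly_P_eq_0_iff ne by blast
  ultimately show False
    using \<open>T t < 0\<close> assms(1) by simp
qed

lemma P_neg_between:
  assumes "1 < \<alpha> * t" "\<forall>b\<in>set bs. b * t < 1"
  shows "poly P t < 0"
proof -
  have "(\<Prod>a\<leftarrow>bs. 1 - a * t) > 0"
    using assms(2) by (induction bs) auto
  then have "(1 - \<alpha> * t) * (\<Prod>a\<leftarrow>bs. 1 - a * t) < 0"
    using assms(1) by (simp add: mult_neg_pos)
  then show ?thesis
    using c_pos by (simp add: poly_P mult_pos_neg)
qed

lemma pos_if_between: "1 < \<alpha> * t \<Longrightarrow> 0 < t"
  by (rule zero_less_mult_pos[of \<alpha>]) (use \<alpha>_pos in linarith)+

text \<open>Rolle's theorem applies to \<open>\<zeta>\<close> between the two smallest zeros of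
  \<open>P\<close>. If there is only one zero, the equation \<open>T t = r\<close> is solved
  explicitly.\<close>

lemma critical_point_exists:
  assumes "\<forall>b\<in>set bs. b < \<alpha>"
  shows "\<exists>t. 1 < \<alpha> * t \<and> (\<forall>b\<in>set bs. b * t < 1) \<and> poly (R_poly P r) t = 0"
proof (cases "bs = []")
  case True
  then have r: "r > 1"
    using nondegenerate by simp
  \<comment> \<open>The solution of \<open>\<alpha> t / (\<alpha> t - 1) = r\<close>, which lies
    beyond \<open>1 / \<alpha>\<close> because \<open>r > 1\<close>.\<close>
  define t where "t = real r / ((real r - 1) * \<alpha>)"
  have at: "\<alpha> * t = real r / (real r - 1)"
    using \<alpha>_pos by (simp add: t_def)
  have "1 < \<alpha> * t"
    unfolding at using r by simp
  moreover have "T t = real r"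
    unfolding T_def using True r by (simp add: at divide_simps)
  moreover have "t \<noteq> 0"
    using r \<alpha>_pos by (simp add: t_def)
  ultimately show ?thesis
    using R_poly_T[of t] True by (intro exI[of _ t]) auto
next
  case False
  define \<beta> where "\<beta> = Max (set bs)"
  have \<beta>: "\<beta> \<in> set bs" "\<forall>b\<in>set bs. b \<le> \<beta>"
    using False by (auto simp: \<beta>_def)
  then have b: "0 < \<beta>" "\<beta> < \<alpha>"
    using bs assms by auto
  then have lt: "1 / \<alpha> < 1 / \<beta>"
    by (simp add: frac_less2)
  have "\<zeta> (1 / \<alpha>) = 0"
    using \<alpha>_pos by (simp add: \<zeta>_def poly_P_eq_0_iff)
  moreover have "\<zeta> (1 / \<beta>) = 0"
    using b \<beta> by (auto simp: \<zeta>_def poly_P_eq_0_iff intro!: bexI[of _ \<beta>])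
  ultimately have eq: "\<zeta> (1 / \<alpha>) = \<zeta> (1 / \<beta>)"
    by simp
  have der: "(\<zeta> has_field_derivative poly (R_poly P r) t / t ^ (2 * r)) (at t)" if "t \<ge> 1 / \<alpha>" for t
  proof (rule \<zeta>_deriv)
    have "0 < 1 / \<alpha>"
      using \<alpha>_pos by simp
    then show "t \<noteq> 0"
      using that by linarith
  qed
  have cont: "continuous_on {1 / \<alpha>..1 / \<beta>} \<zeta>"
    by (rule continuous_at_imp_continuous_on) (use der DERIV_isCont in \<open>meson atLeastAtMost_iff\<close>)
  have "(\<zeta> has_derivative (*) (poly (R_poly P r) t / t ^ (2 * r))) (at t)" if "1 / \<alpha> < t" "t < 1 / \<beta>" for t
    using der[of t] that by (simp add: has_field_derivative_def)
  from Rolle_deriv[OF lt eq cont this]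
  obtain t where t: "1 / \<alpha> < t" "t < 1 / \<beta>" "(*) (poly (R_poly P r) t / t ^ (2 * r)) = (\<lambda>v. 0)"
    by blast
  have "0 < 1 / \<alpha>"
    using \<alpha>_pos by simp
  then have "t \<noteq> 0"
    using t(1) by linarith
  then have "poly (R_poly P r) t = 0"
    using fun_cong[OF t(3), of 1] by simp
  moreover have "1 < \<alpha> * t"
    using t(1) \<alpha>_pos by (simp add: field_simps)
  moreover have "b * t < 1" if "b \<in> set bs" for b
  proof -
    have "b * t \<le> \<beta> * t"
      using \<beta> that pos_if_between[OF \<open>1 < \<alpha> * t\<close>] by (intro mult_right_mono) auto
    also have "\<dots> < 1"
      using t(2) b by (simp add: field_simps)
    finally show ?thesis .
  qed
  ultimately show ?thesis
    by blast
qed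

text \<open>The delicate point is to exclude \<open>t_a = 1 / \<alpha>\<close>: a common zero of
  \<open>R\<close> and \<open>P\<close> would be a zero of \<open>P'\<close>, but this zero of
  \<open>P\<close> is simple.\<close>

lemma t_a_simple:
  assumes "\<forall>b\<in>set bs. b < \<alpha>"
  shows "1 < \<alpha> * t_a P r" "\<forall>b\<in>set bs. b * t_a P r < 1" "poly (R_poly P r) (t_a P r) = 0"
proof -
  let ?S = "{t. 0 < t \<and> poly (R_poly P r) t = 0}"
  obtain t where t: "1 < \<alpha> * t" "\<forall>b\<in>set bs. b * t < 1" "poly (R_poly P r) t = 0"
    using critical_point_exists[OF assms] by blast
  have tS: "t \<in> ?S"
    using t pos_if_between by blast
  have "t_a P r \<in> ?S"
    unfolding t_a_def using tS finite_R_poly_zeros by (intro Min_in) blast+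
  then have ta: "0 < t_a P r" "poly (R_poly P r) (t_a P r) = 0"
    by auto
  have le: "t_a P r \<le> t"
    unfolding t_a_def using tS finite_R_poly_zeros by (intro Min_le) auto
  show "poly (R_poly P r) (t_a P r) = 0"
    by (rule ta)
  show "\<forall>b\<in>set bs. b * t_a P r < 1"
  proof
    fix b assume "b \<in> set bs"
    then have "b * t_a P r \<le> b * t" "b * t < 1"
      using le bs t by auto
    then show "b * t_a P r < 1" by simp
  qed
  show "1 < \<alpha> * t_a P r"
  proof (rule ccontr)
    assume "\<not> 1 < \<alpha> * t_a P r"
    then have eq: "\<alpha> * t_a P r = 1"
      using R_poly_pos_below[OF ta(1)] ta(2) by fastforce
    have "t_a P r * poly (pderiv P) (t_a P r) = 0"
      using R_poly[of "t_a P r"] ta eq poly_P_eq_0_iff[of "t_a P r"] by auto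
    moreover have "poly (pderiv P) t = - (c * \<alpha> * poly (lin_prod bs) t)" if "\<alpha> * t = 1" for t
      using that by (simp add: P_def pderiv_smult pderiv_mult pderiv_pCons mult.commute[of t] del: mult_pCons_left)
    note this[OF eq]
    moreover have "poly (lin_prod bs) (t_a P r) \<noteq> 0"
      using \<open>\<forall>b\<in>set bs. b * t_a P r < 1\<close> by (auto simp: poly_lin_prod prod_list_zero_iff)
    ultimately show False
      using ta c_pos \<alpha>_pos by simp
  qed
qed

text \<open>A multiple zero of \<open>P\<close> is also a zero of \<open>P'\<close>, hence of
  \<open>R\<close>, and no positive zero of \<open>R\<close> comes before the smallest zero of
  \<open>P\<close>.\<close>

lemma t_a_multiple:
  assumes "\<alpha> \<in> set bs"
  shows "t_a P r = 1 / \<alpha>"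
proof -
  let ?S = "{t. 0 < t \<and> poly (R_poly P r) t = 0}"
  have P0: "poly P (1 / \<alpha>) = 0"
    using \<alpha>_pos by (simp add: poly_P_eq_0_iff)
  have "poly (lin_prod bs) (1 / \<alpha>) = 0"
    using assms \<alpha>_pos by (auto simp: poly_lin_prod prod_list_zero_iff)
  then have "poly (pderiv P) (1 / \<alpha>) = 0"
    using \<alpha>_pos by (simp add: P_def pderiv_smult pderiv_mult pderiv_pCons del: mult_pCons_left)
  then have S: "1 / \<alpha> \<in> ?S"
    using R_poly[of "1 / \<alpha>"] P0 \<alpha>_pos by simp
  show ?thesis
    unfolding t_a_def
  proof (rule Min_eqI[OF finite_R_poly_zeros _ S])
    fix t assume "t \<in> ?S"
    then have "\<not> \<alpha> * t < 1"
      using R_poly_pos_below by auto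
    then show "1 / \<alpha> \<le> t"
      using \<alpha>_pos by (simp add: field_simps)
  qed
qed

lemma simple_or_multiple: "(\<forall>b\<in>set bs. b < \<alpha>) \<or> \<alpha> \<in> set bs"
proof (rule disjCI)
  assume "\<alpha> \<notin> set bs"
  then show "\<forall>b\<in>set bs. b < \<alpha>"
    using bs by (metis order_less_le)
qed

lemma endpoint_a_multiple: "\<alpha> \<in> set bs \<Longrightarrow> endpoint_a P r = 0"
  using \<alpha>_pos by (simp add: endpoint_a_def t_a_multiple poly_P_eq_0_iff)

lemma endpoint_a_nonneg: "endpoint_a P r \<ge> 0"
  using simple_or_multiple
proof
  assume "\<forall>b\<in>set bs. b < \<alpha>"
  note ta = t_a_simple[OF this]
  show ?thesis
    using P_neg_between[OF ta(1,2)] pos_if_between[OF ta(1)] by (simp add: endpoint_a_def divide_nonpos_pos)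
qed (use endpoint_a_multiple in simp)

text \<open>Supplies the point \<open>s\<close> that \<open>reciprocal_coeff_pos_lower\<close> asks
  for, namely \<open>t_a\<close>. If the smallest zero is multiple, then \<open>a = 0\<close> and no
  \<open>z\<close> qualifies.\<close>

lemma endpoint_a_witness:
  assumes "0 < z" "z \<le> endpoint_a P r"
  shows "\<exists>s>0. (\<forall>b\<in>set bs. b * s < 1) \<and> poly P s + z * s ^ r \<le> 0"
proof -
  have "\<forall>b\<in>set bs. b < \<alpha>"
    using simple_or_multiple endpoint_a_multiple assms by auto
  note ta = t_a_simple[OF this]
  have pos: "t_a P r > 0"
    using pos_if_between[OF ta(1)] .
  then have "poly P (t_a P r) + z * t_a P r ^ r \<le> 0"
    using assms(2) by (simp add: endpoint_a_def field_simps)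
  then show ?thesis
    using pos ta by blast
qed

text \<open>Between \<open>1 / \<alpha>\<close> and the next zero of \<open>P\<close>, if any,
  \<open>P\<close> is negative and \<open>T\<close> decreases, with value \<open>r\<close> at
  \<open>t_a\<close>. So \<open>\<zeta>\<close> rises before \<open>t_a\<close> and falls after
  it.\<close>

lemma \<zeta>_le_endpoint_a:
  assumes x: "1 < \<alpha> * x" "\<forall>b\<in>set bs. b * x < 1"
  shows "\<zeta> x \<le> endpoint_a P r"
proof -
  have "\<forall>b\<in>set bs. b < \<alpha>"
  proof (rule disjE[OF simple_or_multiple])
    assume "\<alpha> \<in> set bs"
    then have "\<alpha> * x < 1"
      using x(2) by blast
    then show ?thesis
      using x(1) by linarith
  qed
  note ta = t_a_simple[OF this]
  let ?t = "t_a P r"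
  have pos: "?t > 0" "x > 0"
    using pos_if_between[OF ta(1)] pos_if_between[OF x(1)] by simp_all
  have ne: "\<forall>a\<in>set (\<alpha> # bs). a * t \<noteq> 1" if "1 < \<alpha> * t" "\<forall>b\<in>set bs. b * t < 1" for t
    using that by auto
  have "T ?t = real r"
  proof -
    have "?t ^ r * poly P ?t * (real r - T ?t) = 0"
      using R_poly_T[OF ne[OF ta(1,2)]] ta(3) by simp
    then show ?thesis
      using pos P_neg_between[OF ta(1,2)] by simp
  qed
  have sgn: "t * poly (R_poly P r) t = t ^ r * poly P t * (real r - T t)" "t ^ r * poly P t < 0"
    if "1 < \<alpha> * t" "\<forall>b\<in>set bs. b * t < 1" for t
    using R_poly_T[OF ne[OF that]] P_neg_between[OF that] pos_if_between[OF that(1)]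
    by (auto simp: mult_pos_neg)
  have between: "1 < \<alpha> * t \<and> (\<forall>b\<in>set bs. b * t < 1)"
    if "1 < \<alpha> * u" "\<forall>b\<in>set bs. b * v < 1" "u \<le> t" "t \<le> v" for t u v
    using that \<alpha>_pos bs by (meson less_le_trans le_less_trans mult_left_mono less_imp_le)
  have anti: "T v \<le> T u" if "1 < \<alpha> * u" "\<forall>b\<in>set bs. b * v < 1" "u \<le> v" for u v
    unfolding T_def by (rule sum_list_log_deriv_antimono) (use that \<alpha>_pos bs in auto)
  show ?thesis
  proof (cases "x \<le> ?t")
    case True
    have "\<zeta> x \<le> \<zeta> ?t"
    proof (rule DERIV_nonneg_imp_nondecreasing[OF True])
      fix t assume t: "x \<le> t" "t \<le> ?t"
      have tt: "1 < \<alpha> * t" "\<forall>b\<in>set bs. b * t < 1"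
        using between[OF x(1) ta(2) t] by auto
      have "T t \<ge> real r"
        using anti[OF tt(1) ta(2) t(2)] \<open>T ?t = real r\<close> by simp
      then have "t * poly (R_poly P r) t \<ge> 0"
        using sgn[OF tt] by (simp add: mult_nonpos_nonpos)
      then have "poly (R_poly P r) t \<ge> 0"
        using pos t by (simp add: zero_le_mult_iff)
      then show "\<exists>y. (\<zeta> has_real_derivative y) (at t) \<and> 0 \<le> y"
        using \<zeta>_deriv_nonneg[of t] pos t by simp
    qed
    then show ?thesis
      by (simp add: \<zeta>_def endpoint_a_def)
  next
    case False
    then have le: "?t \<le> x" by simp
    have "\<zeta> x \<le> \<zeta> ?t"
    proof (rule DERIV_nonpos_imp_nonincreasing[OF le])
      fix t assume t: "?t \<le> t" "t \<le> x"
      have tt: "1 < \<alpha> * t" "\<forall>b\<in>set bs. b * t < 1"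
        using between[OF ta(1) x(2) t] by auto
      have "T t \<le> real r"
        using anti[OF ta(1) tt(2) t(1)] \<open>T ?t = real r\<close> by simp
      then have "t * poly (R_poly P r) t \<le> 0"
        using sgn[OF tt] by (simp add: mult_nonpos_nonneg)
      then have "poly (R_poly P r) t \<le> 0"
        using pos t by (simp add: mult_le_0_iff)
      then show "\<exists>y. (\<zeta> has_real_derivative y) (at t) \<and> y \<le> 0"
        using \<zeta>_deriv_nonpos[of t] pos t by simp
    qed
    then show ?thesis
      by (simp add: \<zeta>_def endpoint_a_def)
  qed
qed

lemma P_pos_neg: "t \<le> 0 \<Longrightarrow> poly P t > 0"
proof -
  assume "t \<le> 0"
  have "(\<Prod>a\<leftarrow>xs. 1 - a * t) > 0" if "\<forall>a\<in>set xs. 0 < a" for xs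
    using that
  proof (induction xs)
    case (Cons a xs)
    then have "a * t \<le> 0"
      using \<open>t \<le> 0\<close> by (simp add: mult_le_0_iff)
    then show ?case
      using Cons by (auto intro!: mult_pos_pos)
  qed auto
  from this[OF as_pos] show ?thesis
    using c_pos unfolding poly_P by (rule mult_pos_pos[rotated])
qed

lemma t_b_gt1: "r > 1 \<Longrightarrow> t_b P r = 0"
  unfolding t_b_def
  by (rule Max_eqI[OF finite_R_poly_zeros]) (auto simp: R_poly_def poly_monom power_0_left)

lemma neg_lt_1: "t < 0 \<Longrightarrow> \<forall>a\<in>set (\<alpha> # bs). a * t < 1"
  using as_pos by (meson less_trans mult_pos_neg zero_less_one)

lemma neg_ne: "t < 0 \<Longrightarrow> \<forall>a\<in>set (\<alpha> # bs). a * t \<noteq> 1"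
  using neg_lt_1 by (metis less_irrefl)

lemma t_b_1:
  assumes "r = 1"
  shows "t_b P r < 0" "T (t_b P r) = 1"
proof -
  let ?S = "{t. t \<le> 0 \<and> poly (R_poly P r) t = 0}"
  obtain \<beta> bs' where \<beta>: "bs = \<beta> # bs'"
    using nondegenerate assms by (metis less_irrefl neq_Nil_conv)
  \<comment> \<open>At \<open>- 2 / \<beta>\<close> the summands of \<open>\<alpha>\<close> and
    \<open>\<beta>\<close> in \<open>T\<close> both exceed 1/2 and the others are nonnegative, so
    \<open>T > 1\<close> and \<open>R\<close> is negative. Together with \<open>R(0) > 0\<close>
    this yields a negative zero.\<close>
  define s where "s = 2 / \<beta>"
  have s: "0 < \<beta>" "0 < s" "\<beta> * s = 2" "\<alpha> * s \<ge> 2"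
    using bs \<beta> by (auto simp: s_def field_simps)
  have R0: "poly (R_poly P r) 0 > 0"
    using assms c_pos poly_P_0 by (simp add: R_poly_def poly_monom)
  have "T (- s) > 1"
  proof -
    have half: "a * (- s) / (a * (- s) - 1) > 1 / 2" if "a * s \<ge> 2" for a
      using that by (simp add: divide_simps)
    have "\<beta> * (- s) / (\<beta> * (- s) - 1) > 1 / 2" "\<alpha> * (- s) / (\<alpha> * (- s) - 1) > 1 / 2"
      using s by (simp_all only: half order_refl)
    moreover have "(\<Sum>a\<leftarrow>bs'. a * (- s) / (a * (- s) - 1)) \<ge> 0"
    proof (rule sum_list_nonneg)
      fix x assume "x \<in> set (map (\<lambda>a. a * (- s) / (a * (- s) - 1)) bs')"
      then obtain a where "a \<in> set bs'" "x = a * (- s) / (a * (- s) - 1)"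
        by auto
      moreover from this have "a * s > 0"
        using bs \<beta> s by simp
      moreover have "a * (- s) / (a * (- s) - 1) \<ge> 0"
        using \<open>a * s > 0\<close> by (intro divide_nonpos_nonpos) auto
      ultimately show "0 \<le> x"
        by simp
    qed
    moreover have "T (- s) = \<alpha> * (- s) / (\<alpha> * (- s) - 1) + (\<beta> * (- s) / (\<beta> * (- s) - 1)
        + (\<Sum>a\<leftarrow>bs'. a * (- s) / (a * (- s) - 1)))"
      unfolding T_def by (simp add: \<beta>)
    ultimately show ?thesis
      by linarith
  qed
  have ms: "- s < 0"
    using s by simp
  have "(- s) * poly (R_poly P r) (- s) = (- s) * poly P (- s) * (1 - T (- s))"
    using R_poly_T[of "- s", OF neg_ne[OF ms]] assms by simp
  then have "poly (R_poly P r) (- s) = poly P (- s) * (1 - T (- s))"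
    using s by simp
  then have "poly (R_poly P r) (- s) < 0"
    using P_pos_neg[of "- s"] s \<open>T (- s) > 1\<close> by (simp add: mult_pos_neg)
  then obtain t where "- s < t" "t < 0" "poly (R_poly P r) t = 0"
    using poly_IVT_pos[OF ms _ R0] by blast
  then have "t \<in> ?S"
    by auto
  then have "t_b P r \<in> ?S"
    unfolding t_b_def using finite_R_poly_zeros by (intro Max_in) auto
  then have tb: "t_b P r \<le> 0" "poly (R_poly P r) (t_b P r) = 0"
    by auto
  moreover have "t_b P r \<noteq> 0"
    using R0 tb by auto
  ultimately show "t_b P r < 0"
    by simp
  then have "t_b P r ^ r * poly P (t_b P r) * (real r - T (t_b P r)) = 0"
    using R_poly_T[of "t_b P r", OF neg_ne] tb by simp
  then show "T (t_b P r) = 1"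
    using P_pos_neg[OF tb(1)] \<open>t_b P r < 0\<close> assms by simp
qed

lemma endpoint_b_1: "r = 1 \<Longrightarrow> endpoint_b P r = ereal (\<zeta> (t_b P r))"
  unfolding endpoint_b_def \<zeta>_def using t_b_1 by simp

lemma endpoint_b_gt1: "r > 1 \<Longrightarrow> endpoint_b P r = \<infinity>"
  using t_b_gt1 by (simp add: endpoint_b_def)

text \<open>On the negative axis \<open>P\<close> is positive and \<open>T\<close> decreases, with
  value 1 at \<open>t_b\<close>, so \<open>\<zeta>\<close> has its minimum there.\<close>

lemma endpoint_b_le_\<zeta>:
  assumes "r = 1" "x < 0"
  shows "endpoint_b P r \<le> ereal (\<zeta> x)"
proof -
  let ?t = "t_b P r"
  have tb: "?t < 0" "T ?t = 1"
    using t_b_1[OF assms(1)] .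
  have R: "poly (R_poly P r) t = poly P t * (1 - T t)" if "t < 0" for t
    using R_poly_T[of t, OF neg_ne[OF that]] that assms(1) by simp
  have anti: "T v \<le> T u" if "u \<le> v" "v < 0" for u v
    unfolding T_def by (rule sum_list_log_deriv_antimono) (use that as_pos neg_lt_1[OF that(2)] in simp_all)
  have "\<zeta> ?t \<le> \<zeta> x"
  proof (cases "x \<le> ?t")
    case True
    show ?thesis
    proof (rule DERIV_nonpos_imp_nonincreasing[OF True])
      fix t assume t: "x \<le> t" "t \<le> ?t"
      have "T t \<ge> 1"
        using anti[OF t(2)] tb by simp
      then have "poly (R_poly P r) t \<le> 0"
        using R[of t] P_pos_neg[of t] t tb by (simp add: mult_nonneg_nonpos)
      then show "\<exists>y. (\<zeta> has_real_derivative y) (at t) \<and> y \<le> 0"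
        using \<zeta>_deriv_nonpos[of t] t tb by simp
    qed
  next
    case False
    then have le: "?t \<le> x" by simp
    show ?thesis
    proof (rule DERIV_nonneg_imp_nondecreasing[OF le])
      fix t assume t: "?t \<le> t" "t \<le> x"
      have "T t \<le> 1"
        using anti[OF t(1)] tb t assms by simp
      then have "poly (R_poly P r) t \<ge> 0"
        using R[of t] P_pos_neg[of t] t assms by simp
      then show "\<exists>y. (\<zeta> has_real_derivative y) (at t) \<and> 0 \<le> y"
        using \<zeta>_deriv_nonneg[of t] t assms by simp
    qed
  qed
  then show ?thesis
    using endpoint_b_1[OF assms(1)] by simp
qed

end


section \<open>Complex polynomials, unsigned angles and moduli of products\<close>

lemma map_poly_of_real_mult:
  "map_poly complex_of_real (p * q) = map_poly of_real p * map_poly of_real q"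
  by (rule poly_eqI) (simp add: coeff_map_poly coeff_mult)

lemma poly_map_poly_of_real:
  "poly (map_poly complex_of_real p) (of_real x) = of_real (poly p x)"
  by (induction p) (auto simp: map_poly_pCons)

lemma map_poly_of_real_lin_prod:
  "map_poly complex_of_real (lin_prod as) = lin_prod (map of_real as)"
  by (induction as) (simp_all add: map_poly_of_real_mult map_poly_pCons del: mult_pCons_left)

text \<open>The absolute value of the principal argument, for \<open>w \<noteq> 0\<close>. Unlike
  the argument it is continuous across the negative real axis, where the factors
  \<open>1 - a t\<close> can lie when \<open>t\<close> is real.\<close>

definition unsigned_arg :: "complex \<Rightarrow> real" where
  "unsigned_arg w = arccos (Re w / norm w)"

lemma Re_div_norm_bounds: "- 1 \<le> Re w / norm w" "Re w / norm w \<le> 1"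
  using abs_Re_le_cmod[of w] by (cases "w = 0"; simp add: divide_simps abs_le_iff)+

lemma unsigned_arg_cnj [simp]: "unsigned_arg (cnj w) = unsigned_arg w"
  by (simp add: unsigned_arg_def)

lemma unsigned_arg_of_real: "x \<noteq> 0 \<Longrightarrow> unsigned_arg (of_real x) = (if x > 0 then 0 else pi)"
  by (simp add: unsigned_arg_def sgn_real_def [symmetric] arccos_minus_1)

lemma isCont_unsigned_arg: "w \<noteq> 0 \<Longrightarrow> isCont unsigned_arg w"
proof -
  assume w: "w \<noteq> 0"
  have "continuous_on (- {0}) unsigned_arg"
    unfolding unsigned_arg_def
    using Re_div_norm_bounds by (intro continuous_on_arccos continuous_intros) auto
  then show ?thesis
    using w continuous_on_eq_continuous_at[of "- {0}" unsigned_arg] by auto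
qed

lemma polar_unsigned_arg:
  assumes "Im w \<ge> 0"
  shows "w = of_real (norm w) * cis (unsigned_arg w)"
proof (cases "w = 0")
  case False
  define u where "u = Re w / norm w"
  have u: "- 1 \<le> u" "u \<le> 1"
    unfolding u_def by (rule Re_div_norm_bounds)+
  have "norm w * sqrt (1 - u\<^sup>2) = Im w"
  proof -
    have "norm w * sqrt (1 - u\<^sup>2) = sqrt ((norm w)\<^sup>2 * (1 - u\<^sup>2))"
      by (simp add: real_sqrt_mult)
    also have "(norm w)\<^sup>2 * (1 - u\<^sup>2) = (Im w)\<^sup>2"
      using False by (simp add: u_def power_divide cmod_power2 divide_simps)
    finally show ?thesis
      using assms by simp
  qed
  then show ?thesis
    using u False by (intro complex_eqI) (simp_all add: unsigned_arg_def sin_arccos flip: u_def, simp add: u_def)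
qed simp

lemma polar_unsigned_arg':
  assumes "Im w \<le> 0"
  shows "w = of_real (norm w) * cis (- unsigned_arg w)"
proof -
  have "cnj w = of_real (norm (cnj w)) * cis (unsigned_arg (cnj w))"
    using assms by (intro polar_unsigned_arg) simp
  then have "cnj (cnj w) = cnj (of_real (norm w) * cis (unsigned_arg w))"
    by simp
  then show ?thesis
    by (simp add: cis_cnj)
qed

text \<open>\<open>|1 - a t|^2 = 1 - 2 a Re t + a^2 |t|^2\<close>, so on a circle the modulus of
  each factor decreases strictly with \<open>Re t\<close>.\<close>

lemma norm_prod_list_less:
  fixes t u :: complex
  assumes "\<forall>a\<in>set as. 0 < (a::real)" "as \<noteq> []" "norm t = norm u" "Re t < Re u"
  shows "norm (\<Prod>a\<leftarrow>as. 1 - of_real a * u) < norm (\<Prod>a\<leftarrow>as. 1 - of_real a * t)"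
proof -
  have fac: "norm (1 - of_real a * u) < norm (1 - of_real a * t)" if "a > 0" for a :: real
  proof -
    have e: "(norm (1 - of_real a * v))\<^sup>2 = 1 - 2 * a * Re v + a\<^sup>2 * (norm v)\<^sup>2" for v
      unfolding cmod_power2 by (simp add: power2_eq_square algebra_simps)
    have "(norm (1 - of_real a * u))\<^sup>2 < (norm (1 - of_real a * t))\<^sup>2"
      unfolding e using that assms(3,4) by simp
    then show ?thesis
      by (rule power2_less_imp_less) simp
  qed
  \<comment> \<open>The weak inequality and the positivity of the larger product hold for the empty
    list too and carry the induction.\<close>
  have "norm (\<Prod>a\<leftarrow>as. 1 - of_real a * u) \<le> norm (\<Prod>a\<leftarrow>as. 1 - of_real a * t)
      \<and> 0 < norm (\<Prod>a\<leftarrow>as. 1 - of_real a * t)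
      \<and> (as \<noteq> [] \<longrightarrow> norm (\<Prod>a\<leftarrow>as. 1 - of_real a * u) < norm (\<Prod>a\<leftarrow>as. 1 - of_real a * t))"
    using assms(1)
  proof (induction as)
    case (Cons a as)
    let ?U = "norm (\<Prod>a\<leftarrow>as. 1 - of_real a * u)" and ?V = "norm (\<Prod>a\<leftarrow>as. 1 - of_real a * t)"
    have IH: "?U \<le> ?V" "0 < ?V"
      using Cons by auto
    have f: "norm (1 - of_real a * u) < norm (1 - of_real a * t)"
      using fac Cons.prems by simp
    have "norm (1 - of_real a * u) * ?U \<le> norm (1 - of_real a * u) * ?V"
      using IH by (intro mult_left_mono) auto
    also have "\<dots> < norm (1 - of_real a * t) * ?V"
      using f IH by (intro mult_strict_right_mono) auto
    finally have lt: "norm (1 - of_real a * u) * ?U < norm (1 - of_real a * t) * ?V" .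
    moreover have "0 \<le> norm (1 - of_real a * u) * ?U"
      by simp
    ultimately have "0 < norm (1 - of_real a * t) * ?V"
      by linarith
    with lt show ?case
      by (simp add: norm_mult)
  qed simp
  then show ?thesis
    using assms(2) by blast
qed

subsection \<open>The root of smallest modulus\<close>

context positive_zeros
begin

definition Pc :: "complex \<Rightarrow> complex" where "Pc t = poly (map_poly of_real P) t"

lemma Pc_eq: "Pc t = of_real c * (\<Prod>a\<leftarrow>\<alpha> # bs. 1 - of_real a * t)"
  by (simp add: Pc_def P_def map_poly_smult map_poly_of_real_lin_prod poly_lin_prod comp_def
      del: lin_prod_simps list.map)

lemma Pc_of_real: "Pc (of_real x) = of_real (poly P x)"
  by (simp add: Pc_def poly_map_poly_of_real)

lemma Pc_0: "Pc 0 = of_real c"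
  using Pc_of_real[of 0] by (simp add: poly_P_0)

lemma Pc_cnj: "Pc (cnj t) = cnj (Pc t)"
proof -
  have "(\<Prod>a\<leftarrow>as. 1 - of_real a * cnj t) = cnj (\<Prod>a\<leftarrow>as. 1 - of_real a * t)" for as :: "real list"
    by (induction as) auto
  then show ?thesis
    by (simp add: Pc_eq del: list.map)
qed

definition Q :: "complex \<Rightarrow> complex poly" where
  "Q z = map_poly of_real P + monom z r"

lemma poly_Q: "poly (Q z) t = Pc t + z * t ^ r"
  by (simp add: Q_def Pc_def poly_monom)

text \<open>The term \<open>z t^r\<close> can cancel the leading coefficient of \<open>P\<close>
  only when \<open>r\<close> is its degree; then nondegeneracy gives \<open>r \<noteq> 1\<close>,
  and the coefficient of \<open>t\<close> survives.\<close>

lemma degree_Q: "Polynomial.degree (Q z) > 0"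
proof -
  have P: "poly.coeff P i \<noteq> 0" if "i \<le> Suc (length bs)" for i
    using coeff_lin_prod_alternating(2)[OF as_pos, of i] that c_pos
    by (auto simp: P_def simp del: lin_prod_simps)
  have "\<exists>i>0. poly.coeff (Q z) i \<noteq> 0"
  proof (cases "r = Suc (length bs)")
    case True
    then have "r \<noteq> 1"
      using nondegenerate by auto
    then show ?thesis
      using P[of 1] by (intro exI[of _ 1]) (simp add: Q_def coeff_map_poly)
  next
    case False
    then show ?thesis
      using P[of "Suc (length bs)"] by (intro exI[of _ "Suc (length bs)"]) (simp add: Q_def coeff_map_poly)
  qed
  then show ?thesis
    by (meson le_degree less_le_trans)
qed

lemma Q_nz: "Q z \<noteq> 0"
  using degree_Q[of z] by auto

lemma Q_root_nz: "poly (Q z) t = 0 \<Longrightarrow> t \<noteq> 0"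
  using c_pos r_pos by (auto simp: poly_Q Pc_0 zero_power)

definition min_root :: "complex \<Rightarrow> complex \<Rightarrow> bool" where
  "min_root z t \<longleftrightarrow> poly (Q z) t = 0 \<and> (\<forall>u. poly (Q z) u = 0 \<longrightarrow> norm t \<le> norm u)"

lemma min_root_exists: "\<exists>t. min_root z t"
proof -
  let ?S = "{t. poly (Q z) t = 0}"
  have "finite ?S"
    by (rule poly_roots_finite[OF Q_nz])
  moreover have "?S \<noteq> {}"
    using fundamental_theorem_of_algebra_alt[of "Q z"] degree_Q[of z] by force
  ultimately obtain t where "is_arg_min norm (\<lambda>t. t \<in> ?S) t"
    using ex_is_arg_min_if_finite by blast
  then show ?thesis
    by (intro exI[of _ t]) (auto simp: min_root_def is_arg_min_linorder)
qed

definition t1 :: "complex \<Rightarrow> complex" where "t1 z = (SOME t. min_root z t)"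

lemma t1: "min_root z (t1 z)"
  unfolding t1_def using min_root_exists by (rule someI_ex)

text \<open>Roots on one circle share the value \<open>|P(t)| = |z| |t|^r\<close>, and on a circle
  \<open>|P|\<close> determines the real part.\<close>

lemma Q_roots_on_circle:
  assumes "z \<noteq> 0" "poly (Q z) t = 0" "poly (Q z) u = 0" "norm t = norm u"
  shows "u = t \<or> u = cnj t"
proof -
  have nP: "norm (Pc t) = norm z * norm t ^ r" if "poly (Q z) t = 0" for t
  proof -
    have "Pc t = - (z * t ^ r)"
      using that by (simp add: poly_Q eq_neg_iff_add_eq_0)
    then show ?thesis
      by (simp add: norm_mult norm_power)
  qed
  have *: "norm (Pc u) < norm (Pc t)" if "norm t = norm u" "Re t < Re u" for t u
    using norm_prod_list_less[OF as_pos _ that] c_pos by (simp add: Pc_eq norm_mult)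
  have "norm (Pc t) = norm (Pc u)"
    using nP assms by simp
  then have Re: "Re t = Re u"
    using *[OF assms(4)] *[OF assms(4)[symmetric]] by (metis less_irrefl linorder_neqE)
  then have "(Im t)\<^sup>2 = (Im u)\<^sup>2"
    using assms(4) cmod_power2[of t] cmod_power2[of u] by simp
  then have "Im u = Im t \<or> Im u = - Im t"
    by (metis power2_eq_iff)
  then show ?thesis
    using Re by (auto simp: complex_eq_iff)
qed

text \<open>Openness of the map \<open>- P(t) / t^r\<close> provides a root near \<open>t\<close>
  for every nearby parameter. A lower bound for \<open>|Q z|\<close> on the rest of a slightly
  larger disc rules out any other candidate for the smallest root.\<close>

lemma min_root_isCont:
  assumes t: "min_root z t" and uniq: "\<And>u. min_root z u \<Longrightarrow> u = t"
  shows "isCont t1 z"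
proof -
  have root: "poly (Q z) t = 0" and tn: "t \<noteq> 0"
    using t Q_root_nz by (auto simp: min_root_def)
  let ?S = "{u. poly (Q z) u = 0}"
  have fin: "finite ?S"
    by (rule poly_roots_finite[OF Q_nz])
  have bigger: "norm t < norm u" if "u \<in> ?S - {t}" for u
  proof (rule ccontr)
    assume "\<not> norm t < norm u"
    then have "min_root z u"
      using that t unfolding min_root_def by force
    then show False
      using uniq that by blast
  qed
  obtain \<rho> where \<rho>: "norm t < \<rho>" "\<forall>u\<in>?S - {t}. \<rho> < norm u"
  proof (cases "?S - {t} = {}")
    case True
    then show ?thesis
      using that[of "norm t + 1"] by auto
  next
    case False
    define m where "m = Min (norm ` (?S - {t}))"
    have "m \<in> norm ` (?S - {t})"
      unfolding m_def using fin False by (intro Min_in) auto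
    then have "norm t < m"
      using bigger by blast
    then obtain \<rho> where "norm t < \<rho>" "\<rho> < m"
      using dense by blast
    moreover have "m \<le> norm u" if "u \<in> ?S - {t}" for u
      unfolding m_def using fin that by (intro Min_le) auto
    ultimately show ?thesis
      using that by force
  qed
  define \<zeta>c where "\<zeta>c w = - Pc w / w ^ r" for w
  have \<zeta>c: "poly (Q (\<zeta>c w)) w = 0" if "w \<noteq> 0" for w
    using that by (simp add: \<zeta>c_def poly_Q)
  have \<zeta>c_eq: "\<zeta>c w = z' \<longleftrightarrow> poly (Q z') w = 0" if "w \<noteq> 0" for w z'
  proof -
    have "\<zeta>c w = z' \<longleftrightarrow> - Pc w = z' * w ^ r"
      unfolding \<zeta>c_def by (rule nonzero_divide_eq_eq) (use that in simp)
    then show ?thesis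
      by (simp add: poly_Q neg_eq_iff_add_eq_0)
  qed
  show ?thesis
    unfolding isCont_def
  proof (rule tendstoI)
    fix e :: real assume "e > 0"
    define d where "d = min (norm t) (min e (\<rho> - norm t))"
    have d: "d > 0" "d \<le> norm t" "d \<le> \<rho> - norm t"
      using \<open>e > 0\<close> \<rho>(1) tn by (auto simp: d_def)
    have n0: "w \<noteq> 0" if "w \<in> ball t (norm t)" for w
      using that by auto
    have "open (\<zeta>c ` ball t d)"
    proof (rule open_mapping_thm[of \<zeta>c "ball t (norm t)"])
      show "\<zeta>c holomorphic_on ball t (norm t)"
        unfolding \<zeta>c_def Pc_def using n0 by (intro holomorphic_intros) auto
      show "\<not> \<zeta>c constant_on ball t (norm t)"
      proof
        assume "\<zeta>c constant_on ball t (norm t)"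
        then obtain z' where "\<zeta>c w = z'" if "w \<in> ball t (norm t)" for w
          by (auto simp: constant_on_def)
        then have "ball t (norm t) \<subseteq> {w. poly (Q z') w = 0}"
          using \<zeta>c_eq n0 by blast
        moreover have "finite {w. poly (Q z') w = 0}"
          by (rule poly_roots_finite[OF Q_nz])
        ultimately have "finite (ball t (norm t))"
          by (rule finite_subset)
        moreover have "ball t (norm t) \<noteq> {}"
          using tn by simp
        ultimately show False
          using finite_imp_not_open open_ball by blast
      qed
    qed (use d in \<open>auto intro: connected_ball\<close>)
    moreover have "z \<in> \<zeta>c ` ball t d"
      using \<zeta>c_eq[OF tn, of z, symmetric] root d(1) by (intro image_eqI[of _ _ t]) auto
    ultimately have ev1: "eventually (\<lambda>z'. z' \<in> \<zeta>c ` ball t d) (at z)"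
      by (meson eventually_at_topological)
    \<comment> \<open>\<open>K\<close> contains no root of \<open>Q z\<close>. A root
      \<open>t'\<close> of \<open>Q z'\<close> has \<open>Q z\<close> equal to
      \<open>(z - z') t'^r\<close>, which is too small on \<open>K\<close> once \<open>z'\<close> is
      close to \<open>z\<close>.\<close>
    define K where "K = cball 0 \<rho> - ball t e"
    have "compact K"
      unfolding K_def by (intro compact_diff compact_cball open_ball)
    have Knz: "poly (Q z) w \<noteq> 0" if "w \<in> K" for w
    proof
      assume "poly (Q z) w = 0"
      moreover have "w \<noteq> t"
        using that \<open>e > 0\<close> by (auto simp: K_def)
      ultimately have "\<rho> < norm w"
        using \<rho>(2) by blast
      then show False
        using that by (simp add: K_def)
    qed
    obtain \<delta> where \<delta>: "\<delta> > 0" "\<forall>w\<in>K. \<delta> \<le> norm (poly (Q z) w)"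
    proof (cases "K = {}")
      case True
      then show ?thesis using that[of 1] by simp
    next
      case False
      obtain w where "w \<in> K" "\<forall>v\<in>K. norm (poly (Q z) w) \<le> norm (poly (Q z) v)"
        using continuous_attains_inf[OF \<open>compact K\<close> False, of "\<lambda>w. norm (poly (Q z) w)"]
        by (force intro!: continuous_intros)
      then show ?thesis
        using that[of "norm (poly (Q z) w)"] Knz by simp
    qed
    have "((\<lambda>z'. norm (z' - z) * \<rho> ^ r) \<longlongrightarrow> norm (z - z) * \<rho> ^ r) (at z)"
      by (intro tendsto_intros)
    then have ev2: "eventually (\<lambda>z'. norm (z' - z) * \<rho> ^ r < \<delta>) (at z)"
      using \<delta>(1) by (auto dest: order_tendstoD(2))
    have main: "dist (t1 z') t < e" if z1: "z' \<in> \<zeta>c ` ball t d" and z2: "norm (z' - z) * \<rho> ^ r < \<delta>" for z'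
    proof -
      obtain w where w: "w \<in> ball t d" "z' = \<zeta>c w"
        using z1 by blast
      have "w \<noteq> 0"
        using n0 w d(2) by auto
      then have "norm (t1 z') \<le> norm w"
        using t1[of z'] \<zeta>c w by (auto simp: min_root_def)
      also have "norm w \<le> norm t + dist t w"
        using norm_triangle_sub[of w t] by (simp add: dist_norm norm_minus_commute)
      also have "\<dots> < \<rho>"
        using w d(3) by simp
      finally have small: "norm (t1 z') < \<rho>" .
      have "t1 z' \<notin> K"
      proof
        assume "t1 z' \<in> K"
        then have "\<delta> \<le> norm (poly (Q z) (t1 z'))"
          using \<delta> by blast
        also have "poly (Q z) (t1 z') = - ((z' - z) * t1 z' ^ r)"
        proof -
          have "poly (Q z') (t1 z') = 0"
            using t1 by (simp add: min_root_def)
          then show ?thesis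
            by (simp add: poly_Q algebra_simps)
        qed
        also have "norm (- ((z' - z) * t1 z' ^ r)) = norm (z' - z) * norm (t1 z') ^ r"
          by (simp add: norm_mult norm_power)
        also have "\<dots> \<le> norm (z' - z) * \<rho> ^ r"
          using small by (intro mult_left_mono power_mono) auto
        finally show False
          using z2 by simp
      qed
      then show ?thesis
        using small by (simp add: K_def dist_commute)
    qed
    have "t1 z = t"
      using uniq t1 by blast
    show "eventually (\<lambda>z'. dist (t1 z') (t1 z) < e) (at z)"
      unfolding \<open>t1 z = t\<close> using ev1 ev2 by eventually_elim (rule main)
  qed
qed

text \<open>For \<open>Im t \<ge> 0\<close> this is a continuous choice of \<open>- arg (P(t) / t\<^sup>r)\<close>.\<close>

definition \<Phi> :: "complex \<Rightarrow> real" where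
  "\<Phi> t = (\<Sum>a\<leftarrow>\<alpha> # bs. unsigned_arg (1 - of_real a * t)) + real r * unsigned_arg t"

lemma \<Phi>_cnj: "\<Phi> (cnj t) = \<Phi> t"
proof -
  have "unsigned_arg (1 - of_real a * cnj t) = unsigned_arg (1 - of_real a * t)" for a :: real
    using unsigned_arg_cnj[of "1 - of_real a * t"] by simp
  then show ?thesis
    by (simp add: \<Phi>_def)
qed

lemma isCont_\<Phi>:
  assumes "t \<noteq> 0" "Pc t \<noteq> 0"
  shows "isCont \<Phi> t"
proof -
  have "isCont (\<lambda>t. \<Sum>a\<leftarrow>as. unsigned_arg (1 - of_real a * t)) t"
    if "\<forall>a\<in>set as. 1 - of_real a * t \<noteq> 0" for as
    using that
  proof (induction as)
    case (Cons a as)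
    have "isCont (\<lambda>t. unsigned_arg (1 - of_real a * t)) t"
      by (rule isCont_o2[OF _ isCont_unsigned_arg]) (use Cons.prems in \<open>auto intro!: continuous_intros\<close>)
    then show ?case
      using Cons by (auto intro!: continuous_intros)
  qed simp
  moreover have "\<forall>a\<in>set (\<alpha> # bs). 1 - of_real a * t \<noteq> 0"
    using assms(2) by (auto simp: Pc_eq prod_list_zero_iff)
  ultimately show ?thesis
    unfolding \<Phi>_def using isCont_unsigned_arg[OF assms(1)] by (intro continuous_intros) blast+
qed

text \<open>For \<open>Im t \<ge> 0\<close> the factors \<open>1 - a t\<close> lie in the closed
  lower half plane, so the negatives of their unsigned angles add up to a genuine argument of
  \<open>P(t)\<close>. The other half plane follows by conjugation.\<close>

lemma \<Phi>_eq_pi: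
  assumes "\<Phi> t = pi" "t \<noteq> 0"
  shows "Pc t = - of_real (norm (Pc t) / norm t ^ r) * t ^ r"
proof -
  have *: "Pc t * of_real (norm t ^ r) = - of_real (norm (Pc t)) * t ^ r" if "Im t \<ge> 0" "\<Phi> t = pi" for t
  proof -
    define S where "S = (\<Sum>a\<leftarrow>\<alpha> # bs. unsigned_arg (1 - of_real a * t))"
    have "(\<Prod>a\<leftarrow>as. 1 - of_real a * t)
        = of_real (norm (\<Prod>a\<leftarrow>as. 1 - of_real a * t)) * cis (- (\<Sum>a\<leftarrow>as. unsigned_arg (1 - of_real a * t)))"
      if "\<forall>a\<in>set as. 0 < a" for as :: "real list"
      using that
    proof (induction as)
      case (Cons a as)
      have "1 - of_real a * t = of_real (norm (1 - of_real a * t)) * cis (- unsigned_arg (1 - of_real a * t))"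
        using Cons.prems \<open>Im t \<ge> 0\<close> by (intro polar_unsigned_arg') simp
      moreover have "(\<Prod>a\<leftarrow>as. 1 - of_real a * t)
        = of_real (norm (\<Prod>a\<leftarrow>as. 1 - of_real a * t)) * cis (- (\<Sum>a\<leftarrow>as. unsigned_arg (1 - of_real a * t)))"
        using Cons by simp
      ultimately have "(1 - of_real a * t) * (\<Prod>a\<leftarrow>as. 1 - of_real a * t)
        = (of_real (norm (1 - of_real a * t)) * cis (- unsigned_arg (1 - of_real a * t))) *
          (of_real (norm (\<Prod>a\<leftarrow>as. 1 - of_real a * t)) * cis (- (\<Sum>a\<leftarrow>as. unsigned_arg (1 - of_real a * t))))"
        by presburger
      also have "\<dots> = of_real (norm (1 - of_real a * t) * norm (\<Prod>a\<leftarrow>as. 1 - of_real a * t)) *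
          cis (- unsigned_arg (1 - of_real a * t) + - (\<Sum>a\<leftarrow>as. unsigned_arg (1 - of_real a * t)))"
        unfolding cis_mult [symmetric] by simp
      finally show ?case
        by (simp add: norm_mult)
    qed simp
    from this[OF as_pos] have "Pc t = of_real (norm (Pc t)) * cis (- S)"
      using c_pos unfolding Pc_eq S_def by (simp add: norm_mult mult.assoc del: list.map)
    moreover have "S = pi - real r * unsigned_arg t"
      using that(2) by (simp add: \<Phi>_def S_def)
    moreover have "cis (- (pi - real r * unsigned_arg t)) = - cis (real r * unsigned_arg t)"
      by (simp add: complex_eq_iff cos_diff sin_diff)
    ultimately have eq1: "Pc t = - of_real (norm (Pc t)) * cis (real r * unsigned_arg t)"
      by simp
    have "t ^ r = (of_real (norm t) * cis (unsigned_arg t)) ^ r"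
      using polar_unsigned_arg[OF that(1)] by simp
    also have "\<dots> = of_real (norm t ^ r) * cis (real r * unsigned_arg t)"
      by (simp only: power_mult_distrib Complex.DeMoivre of_real_power)
    finally have eq2: "t ^ r = of_real (norm t ^ r) * cis (real r * unsigned_arg t)" .
    have "Pc t * of_real (norm t ^ r) = (- of_real (norm (Pc t)) * cis (real r * unsigned_arg t)) * of_real (norm t ^ r)"
      by (rule arg_cong[OF eq1, of "\<lambda>v. v * of_real (norm t ^ r)"])
    also have "\<dots> = - of_real (norm (Pc t)) * (of_real (norm t ^ r) * cis (real r * unsigned_arg t))"
      by (simp only: mult_ac)
    also have "of_real (norm t ^ r) * cis (real r * unsigned_arg t) = t ^ r"
      by (rule eq2[symmetric])
    finally show ?thesis .
  qed
  have "Pc t * of_real (norm t ^ r) = - of_real (norm (Pc t)) * t ^ r"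
  proof (cases "Im t \<ge> 0")
    case False
    then have "cnj (Pc (cnj t) * of_real (norm (cnj t) ^ r)) = cnj (- of_real (norm (Pc (cnj t))) * cnj t ^ r)"
      using *[of "cnj t"] assms by (simp add: \<Phi>_cnj)
    then show ?thesis
      by (simp add: Pc_cnj)
  qed (use * assms in blast)
  then show ?thesis
    using assms(2) by (simp add: field_simps)
qed

lemma \<Phi>_root_eq_pi_imp_real:
  assumes "\<Phi> t = pi" "poly (Q z) t = 0"
  shows "Im z = 0"
proof -
  define k where "k = norm (Pc t) / norm t ^ r"
  have "t \<noteq> 0"
    using Q_root_nz assms(2) by blast
  have "Pc t = - of_real k * t ^ r"
    unfolding k_def by (rule \<Phi>_eq_pi[OF assms(1) \<open>t \<noteq> 0\<close>])
  then have "(z - of_real k) * t ^ r = 0"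
    using assms(2) by (simp add: poly_Q algebra_simps)
  then have "z = of_real k"
    using \<open>t \<noteq> 0\<close> by simp
  then show ?thesis
    by simp
qed

text \<open>The only rival is the conjugate, and if both \<open>t\<close> and \<open>cnj t\<close>
  are roots then \<open>z = cnj z\<close>.\<close>

lemma min_root_unique_upper:
  assumes "Im z > 0" "min_root z t" "min_root z u"
  shows "u = t"
proof -
  have "z \<noteq> 0"
    using assms(1) by auto
  moreover have "norm t = norm u"
    using assms(2,3) by (simp add: min_root_def antisym)
  ultimately have "u = t \<or> u = cnj t"
    using assms(2,3) by (intro Q_roots_on_circle[of z]) (auto simp: min_root_def)
  moreover have False if "u = cnj t"
  proof -
    have e: "Pc (cnj t) + z * cnj t ^ r = 0" "Pc t + z * t ^ r = 0"
      using assms(2,3) that by (auto simp: min_root_def poly_Q)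
    have "t \<noteq> 0"
      using assms(2) Q_root_nz[of z t] by (simp add: min_root_def)
    have "Pc t + cnj z * t ^ r = cnj (Pc (cnj t) + z * cnj t ^ r)"
      by (simp add: Pc_cnj)
    also have "\<dots> = 0"
      unfolding e by simp
    finally have "(Pc t + z * t ^ r) - (Pc t + cnj z * t ^ r) = 0"
      unfolding e by simp
    then have "(z - cnj z) * t ^ r = 0"
      by (simp add: left_diff_distrib)
    then have "z = cnj z"
      using \<open>t \<noteq> 0\<close> by simp
    then show False
      using assms(1) by (simp add: complex_eq_iff)
  qed
  ultimately show ?thesis
    by blast
qed

text \<open>Roots satisfy \<open>P(t) = t^r\<close>. The sign change of \<open>f\<close> before
  \<open>1 / \<alpha>\<close> bounds the smallest modulus. A smallest root off the positive axis
  would make \<open>f\<close> negative at its modulus and so produce a smaller positive root. Hence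
  \<open>\<Phi> = 0\<close> at the start of the path.\<close>

lemma min_root_minus_one:
  assumes "min_root (- 1) t"
  shows "t = of_real (norm t)" "\<alpha> * norm t < 1"
proof -
  define f where "f x = poly P x - x ^ r" for x
  have f: "poly (Q (- 1)) (of_real x) = of_real (f x)" for x
    by (simp add: poly_Q Pc_of_real f_def)
  have cont: "continuous_on S f" for S
    unfolding f_def by (intro continuous_intros)
  have f0: "f 0 > 0"
    using c_pos r_pos by (simp add: f_def poly_P_0 zero_power)
  have low: "norm t < x" if "x > 0" "f x < 0" for x
  proof -
    have "\<exists>y\<ge>0. y \<le> x \<and> f y = 0"
      by (rule IVT2') (use that f0 cont in auto)
    then obtain y where "0 \<le> y" "y \<le> x" "f y = 0"
      by blast
    moreover from this have "norm t \<le> norm (complex_of_real y)"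
      using assms f unfolding min_root_def by (metis of_real_0)
    moreover have "y \<noteq> x"
      using that \<open>f y = 0\<close> by auto
    ultimately show ?thesis
      by simp
  qed
  have "f (1 / \<alpha>) < 0"
  proof -
    have "poly P (1 / \<alpha>) = 0"
      using \<alpha>_pos by (simp add: poly_P_eq_0_iff)
    then show ?thesis
      using \<alpha>_pos by (simp add: f_def)
  qed
  then have "norm t < 1 / \<alpha>"
    using low \<alpha>_pos by simp
  then show at: "\<alpha> * norm t < 1"
    using \<alpha>_pos by (simp add: field_simps)
  have tn: "t \<noteq> 0"
    using assms Q_root_nz by (auto simp: min_root_def)
  have "\<not> Re t < norm t"
  proof
    assume "Re t < norm t"
    then have "norm (Pc (of_real (norm t))) < norm (Pc t)"
      using norm_prod_list_less[OF as_pos _ , of t "of_real (norm t)"] c_pos by (simp add: Pc_eq norm_mult)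
    also have "Pc t = t ^ r"
      using assms by (simp add: min_root_def poly_Q)
    finally have "f (norm t) < 0"
      by (simp add: f_def Pc_of_real norm_power)
    then show False
      using low[of "norm t"] tn by simp
  qed
  then have "Re t = norm t"
    using complex_Re_le_cmod[of t] by simp
  moreover from this have "Im t = 0"
    using cmod_power2[of t] by simp
  ultimately show "t = of_real (norm t)"
    by (simp add: complex_eq_iff)
qed

lemma \<Phi>_of_real:
  assumes "x \<noteq> 0" "poly P x \<noteq> 0"
  shows "\<Phi> (of_real x) = (\<Sum>a\<leftarrow>\<alpha> # bs. if a * x < 1 then 0 else pi) + real r * (if x > 0 then 0 else pi)"
proof -
  have "unsigned_arg (1 - of_real a * of_real x) = (if a * x < 1 then 0 else pi)" if "a \<in> set (\<alpha> # bs)" for a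
  proof -
    have "1 - a * x \<noteq> 0"
      using assms(2) that poly_P_eq_0_iff by fastforce
    from unsigned_arg_of_real[OF this] show ?thesis
      by simp
  qed
  then have "(\<Sum>a\<leftarrow>\<alpha> # bs. unsigned_arg (1 - of_real a * of_real x)) = (\<Sum>a\<leftarrow>\<alpha> # bs. if a * x < 1 then 0 else pi)"
    by (intro arg_cong[of _ _ sum_list] map_cong) auto
  then show ?thesis
    by (simp only: \<Phi>_def unsigned_arg_of_real[OF assms(1)])
qed

text \<open>Along a path from \<open>- 1\<close> through the upper half plane the smallest root moves
  continuously, and \<open>\<Phi>\<close> cannot cross \<open>\<pi>\<close> there because \<open>z\<close> would be real.\<close>

lemma \<Phi>_min_root_lt_2pi:
  assumes "z0 > 0" "min_root (of_real z0) (of_real x)"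
  shows "\<Phi> (of_real x) < 2 * pi"
proof (rule ccontr)
  assume "\<not> ?thesis"
  then have ge: "\<Phi> (of_real x) \<ge> 2 * pi" by simp
  define C where "C = closed_segment (- 1) \<i> \<union> closed_segment \<i> (of_real z0)"
  have C: "w = - 1 \<or> w = of_real z0 \<or> Im w > 0" if "w \<in> C" for w
    using that unfolding C_def
  proof
    assume "w \<in> closed_segment (- 1) \<i>"
    then obtain u where "0 \<le> u" "w = (1 - u) *\<^sub>R (- 1) + u *\<^sub>R \<i>"
      by (auto simp: closed_segment_def)
    then show ?thesis
      by (cases "u = 0") auto
  next
    assume "w \<in> closed_segment \<i> (of_real z0)"
    then obtain u where "u \<le> 1" "w = (1 - u) *\<^sub>R \<i> + u *\<^sub>R of_real z0"
      by (auto simp: closed_segment_def)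
    then show ?thesis
      by (cases "u = 1") (auto simp: scaleR_conv_of_real)
  qed
  \<comment> \<open>A real root of smallest modulus equals its conjugate and so has no rival; this
    gives continuity of \<open>t1\<close> even at the real end of the path.\<close>
  have uniq0: "u = of_real x" if "min_root (of_real z0) u" for u
  proof -
    have "norm (complex_of_real x) = norm u"
      using that assms(2) unfolding min_root_def by (intro antisym) blast+
    then have "u = of_real x \<or> u = cnj (of_real x)"
      using that assms by (intro Q_roots_on_circle[of "of_real z0"]) (auto simp: min_root_def)
    then show ?thesis
      by simp
  qed
  have uniq1: "u = t" if "min_root (- 1) t" "min_root (- 1) u" for t u
  proof -
    have "norm t = norm u"
      using that by (simp add: min_root_def antisym)
    then show ?thesis
      using min_root_minus_one(1)[OF that(1)] min_root_minus_one(1)[OF that(2)] by simp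
  qed
  have uniq: "u = t" if "w \<in> C" "min_root w t" "min_root w u" for w t u
    using C[OF that(1)]
  proof (elim disjE)
    assume "w = of_real z0"
    then show ?thesis
      using uniq0 that(2,3) by blast
  qed (use that(2,3) uniq1 min_root_unique_upper in blast)+
  have nz: "w \<noteq> 0" if "w \<in> C" for w
    using C[OF that] assms(1) by auto
  have Pcnz: "Pc (t1 w) \<noteq> 0" "t1 w \<noteq> 0" if "w \<in> C" for w
    using t1[of w] nz[OF that] Q_root_nz[of w "t1 w"] by (auto simp: min_root_def poly_Q)
  have "continuous_on C (\<lambda>w. \<Phi> (t1 w))"
  proof (rule continuous_at_imp_continuous_on, rule ballI)
    fix w assume w: "w \<in> C"
    have "isCont t1 w"
      by (rule min_root_isCont[OF t1]) (use uniq[OF w] t1 in blast)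
    then show "isCont (\<lambda>w. \<Phi> (t1 w)) w"
      using isCont_\<Phi>[OF Pcnz(2,1)[OF w]] by (rule isCont_o2)
  qed
  moreover have "connected C"
    unfolding C_def by (rule connected_Un) auto
  ultimately have con: "connected ((\<lambda>w. \<Phi> (t1 w)) ` C)"
    by (rule connected_continuous_image)
  have m1: "- 1 \<in> C" and mz: "of_real z0 \<in> C"
    by (auto simp: C_def)
  have "\<Phi> (t1 (- 1)) = 0"
  proof -
    define y where "y = norm (t1 (- 1))"
    have y: "t1 (- 1) = of_real y" "\<alpha> * y < 1" "y > 0"
      using min_root_minus_one[OF t1] Pcnz(2)[OF m1] by (auto simp: y_def)
    have "a * y < 1" if "a \<in> set (\<alpha> # bs)" for a
    proof -
      have "a * y \<le> \<alpha> * y"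
        using that bs y by (intro mult_right_mono) auto
      then show ?thesis
        using y(2) by linarith
    qed
    then have "(\<Sum>a\<leftarrow>\<alpha> # bs. if a * y < 1 then 0 else pi) = (\<Sum>a\<leftarrow>\<alpha> # bs. 0)"
      by (intro arg_cong[of _ _ sum_list] map_cong) auto
    moreover have "poly P y \<noteq> 0"
      using Pcnz(1)[OF m1] y(1) Pc_of_real[of y] by simp
    ultimately show ?thesis
      using \<Phi>_of_real[of y] y by simp
  qed
  moreover have "\<Phi> (t1 (of_real z0)) \<ge> 2 * pi"
    using ge uniq0[OF t1] by simp
  ultimately have "pi \<in> (\<lambda>w. \<Phi> (t1 w)) ` C"
    using pi_gt_zero by (intro connectedD_interval[OF con imageI[OF m1] imageI[OF mz]]) linarith+
  then obtain w where w: "w \<in> C" "\<Phi> (t1 w) = pi"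
    by auto
  have "Im w = 0"
    using \<Phi>_root_eq_pi_imp_real[OF w(2)] t1[of w] by (auto simp: min_root_def)
  then have "w = - 1 \<or> w = of_real z0"
    using C[OF w(1)] by auto
  then show False
    using w(2) \<open>\<Phi> (t1 (- 1)) = 0\<close> \<open>\<Phi> (t1 (of_real z0)) \<ge> 2 * pi\<close> pi_gt_zero by auto
qed

text \<open>A real root \<open>x\<close> would have \<open>\<Phi> \<ge> 2\<pi>\<close>. For
  \<open>x > 0\<close>, \<open>P(x) < 0\<close> puts \<open>x\<close> past the first zero of
  \<open>P\<close>, and \<open>z > a\<close> puts it past the second, counted with multiplicity. For
  \<open>x < 0\<close>, \<open>z < b\<close> excludes \<open>r = 1\<close>, and the factor
  \<open>t^r\<close> alone contributes \<open>r \<pi>\<close>.\<close>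

lemma min_root_nonreal:
  assumes "endpoint_a P r < z" "ereal z < endpoint_b P r" "min_root (of_real z) t"
  shows "Im t \<noteq> 0"
proof
  assume "Im t = 0"
  then obtain x where x: "t = of_real x"
    by (metis complex_is_Real_iff Reals_cases)
  have z: "z > 0"
    using endpoint_a_nonneg assms(1) by simp
  have root: "poly P x + z * x ^ r = 0"
  proof -
    have "complex_of_real (poly P x + z * x ^ r) = 0"
      using assms(3) x by (simp add: min_root_def poly_Q Pc_of_real)
    then show ?thesis
      by (simp only: of_real_eq_0_iff)
  qed
  have xn: "x \<noteq> 0"
    using assms(3) Q_root_nz[of "of_real z" t] x by (auto simp: min_root_def)
  have \<zeta>x: "\<zeta> x = z"
    using root xn by (simp add: \<zeta>_def field_simps add_eq_0_iff)
  have Pn: "poly P x \<noteq> 0"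
    using root xn z by auto
  have ge: "(\<Sum>a\<leftarrow>bs. if a * x < 1 then 0 else pi) \<ge> 0"
    by (rule sum_list_nonneg) auto
  have "\<Phi> (of_real x) \<ge> 2 * pi"
  proof (cases "x > 0")
    case True
    have "poly P x < 0"
    proof -
      have "z * x ^ r > 0"
        using True z by simp
      then show ?thesis
        using root by linarith
    qed
    have 1: "\<alpha> * x > 1"
    proof (rule ccontr)
      assume n: "\<not> \<alpha> * x > 1"
      have "1 - a * x \<ge> 0" if "a \<in> set (\<alpha> # bs)" for a
      proof -
        have "a * x \<le> \<alpha> * x"
          using that bs True by (intro mult_right_mono) auto
        then show ?thesis
          using n by simp
      qed
      then have "(\<Prod>a\<leftarrow>\<alpha> # bs. 1 - a * x) \<ge> 0"
        by (intro prod_list_nonneg) auto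
      then show False
        using \<open>poly P x < 0\<close> c_pos unfolding poly_P by (meson less_imp_le mult_nonneg_nonneg not_le)
    qed
    have "\<not> (\<forall>b\<in>set bs. b * x < 1)"
      using \<zeta>_le_endpoint_a[OF 1] \<zeta>x assms(1) by auto
    then obtain b where b: "b \<in> set bs" "\<not> b * x < 1"
      by blast
    have "(if b * x < 1 then 0 else pi) \<le> (\<Sum>a\<leftarrow>bs. if a * x < 1 then 0 else pi)"
      by (rule member_le_sum_list) (use b in auto)
    then have "pi \<le> (\<Sum>a\<leftarrow>bs. if a * x < 1 then 0 else pi)"
      using b by simp
    then show ?thesis
      using \<Phi>_of_real[OF xn Pn] True 1 by simp
  next
    case False
    then have "x < 0"
      using xn by simp
    have "r \<noteq> 1"
      using endpoint_b_le_\<zeta>[OF _ \<open>x < 0\<close>] \<zeta>x assms(2) by auto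
    then have "real r \<ge> 2"
      using r_pos by simp
    then have "2 * pi \<le> real r * pi"
      by simp
    moreover have "\<Phi> (of_real x) \<ge> real r * pi"
      using \<Phi>_of_real[OF xn Pn] \<open>x < 0\<close> ge by simp
    ultimately show ?thesis
      by (rule order_trans)
  qed
  then show False
    using \<Phi>_min_root_lt_2pi[OF z, of x] assms(3) x by simp
qed

text \<open>A double root would satisfy the complex form of \<open>T t = r\<close>, but the
  imaginary parts of all summands have the sign opposite to \<open>Im t\<close> and cannot
  cancel.\<close>

lemma nonreal_root_simple:
  assumes "Im t \<noteq> 0" "poly (Q z) t = 0" "Pc t \<noteq> 0"
  shows "poly (pderiv (Q z)) t \<noteq> 0"
proof
  assume d: "poly (pderiv (Q z)) t = 0"
  define as where "as = map complex_of_real (\<alpha> # bs)"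
  have ne: "\<forall>a\<in>set as. a * t \<noteq> 1"
    using assms(3) by (auto simp: as_def Pc_eq prod_list_zero_iff)
  have tn: "t * t ^ (r - 1) = t ^ r"
    using r_pos by (cases r) auto
  have mp: "map_poly of_real P = smult (of_real c) (lin_prod as)"
    by (simp add: P_def map_poly_smult map_poly_of_real_lin_prod as_def del: lin_prod_simps list.map)
  have Pct: "Pc t = of_real c * poly (lin_prod as) t"
    unfolding Pc_def mp by simp
  have "0 = t * poly (pderiv (Q z)) t"
    using d by simp
  also have "\<dots> = t * poly (pderiv (map_poly of_real P)) t + of_nat r * (z * (t * t ^ (r - 1)))"
    by (simp add: Q_def pderiv_add pderiv_monom poly_monom algebra_simps)
  also have "z * (t * t ^ (r - 1)) = - Pc t"
    unfolding tn using assms(2) by (simp add: poly_Q add_eq_0_iff2)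
  also have "t * poly (pderiv (map_poly of_real P)) t = Pc t * (\<Sum>a\<leftarrow>as. a * t / (a * t - 1))"
    using pderiv_lin_prod[OF ne] by (simp add: mp Pct pderiv_smult mult.left_commute)
  also have "Pc t * (\<Sum>a\<leftarrow>as. a * t / (a * t - 1)) + of_nat r * - Pc t
      = Pc t * ((\<Sum>a\<leftarrow>as. a * t / (a * t - 1)) - of_nat r)"
    by (simp add: right_diff_distrib mult.commute)
  finally have "Pc t * ((\<Sum>a\<leftarrow>as. a * t / (a * t - 1)) - of_nat r) = 0"
    by (rule sym)
  then have sum: "(\<Sum>a\<leftarrow>as. a * t / (a * t - 1)) = of_nat r"
    using assms(3) by simp
  define g where "g a = a / (norm (of_real a * t - 1))\<^sup>2" for a
  have Im1: "Im (of_real a * t / (of_real a * t - 1)) = - Im t * g a" if "a \<in> set (\<alpha> # bs)" for a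
  proof -
    have nz: "of_real a * t - 1 \<noteq> 0"
      using ne that by (auto simp: as_def)
    then have "of_real a * t / (of_real a * t - 1) = 1 + 1 / (of_real a * t - 1)"
      by (simp add: field_simps)
    then have "Im (of_real a * t / (of_real a * t - 1)) = Im (1 / (of_real a * t - 1))"
      by simp
    also have "\<dots> = - Im t * g a"
      by (simp add: g_def Im_divide cmod_power2)
    finally show ?thesis .
  qed
  have "Im (\<Sum>a\<leftarrow>xs. of_real a * t / (of_real a * t - 1)) = - Im t * (\<Sum>a\<leftarrow>xs. g a)"
    if "set xs \<subseteq> set (\<alpha> # bs)" for xs
    using that
  proof (induction xs)
    case (Cons a xs)
    then show ?case
      using Im1[of a] by (simp add: algebra_simps)
  qed simp
  then have "Im (\<Sum>a\<leftarrow>\<alpha> # bs. of_real a * t / (of_real a * t - 1)) = - Im t * (\<Sum>a\<leftarrow>\<alpha> # bs. g a)"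
    by blast
  moreover have "(\<Sum>a\<leftarrow>\<alpha> # bs. of_real a * t / (of_real a * t - 1)) = of_nat r"
    using sum by (simp add: as_def comp_def)
  ultimately have "- Im t * (\<Sum>a\<leftarrow>\<alpha> # bs. g a) = 0"
    by (simp del: sum_list.Cons list.map)
  moreover have "(\<Sum>a\<leftarrow>\<alpha> # bs. g a) > 0"
  proof -
    have "of_real \<alpha> * t - 1 \<noteq> 0"
      using ne by (simp add: as_def)
    then have "g \<alpha> > 0"
      using \<alpha>_pos by (simp add: g_def)
    moreover have "(\<Sum>a\<leftarrow>bs. g a) \<ge> 0"
      using bs by (intro sum_list_nonneg) (auto simp: g_def)
    ultimately show ?thesis
      by simp
  qed
  ultimately show False
    using assms(1) by simp
qed

end


subsection \<open>Asymptotics and density\<close>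

text \<open>The finitely many zeros of \<open>W\<close> leave a margin beyond \<open>s\<close>, so
  convergence includes the boundary circle, on which the point \<open>1 / l\<close> of
  \<open>reciprocal_coeff_asymptotics\<close> lies.\<close>

lemma sums_reciprocal_poly:
  fixes W :: "complex poly"
  assumes nz: "\<And>x. norm x \<le> s \<Longrightarrow> poly W x \<noteq> 0" and x: "norm x \<le> s"
    and w: "fps_of_poly W * w = 1"
  shows "(\<lambda>n. fps_nth w n * x ^ n) sums (1 / poly W x)"
proof -
  have s: "s \<ge> 0"
    using x norm_ge_zero order_trans by blast
  have "W \<noteq> 0"
    using nz[OF x] by auto
  then have fin: "finite {y. poly W y = 0}"
    by (rule poly_roots_finite)
  obtain R where R: "s < R" "\<forall>y. poly W y = 0 \<longrightarrow> R \<le> norm y"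
  proof (cases "{y. poly W y = 0} = {}")
    case True
    then show ?thesis
      using that[of "s + 1"] by auto
  next
    case False
    define m where "m = Min (norm ` {y. poly W y = 0})"
    have "m \<in> norm ` {y. poly W y = 0}"
      unfolding m_def using fin False by (intro Min_in) auto
    then have "s < m"
      using nz by force
    moreover have "m \<le> norm y" if "poly W y = 0" for y
      unfolding m_def using fin that by (intro Min_le) auto
    ultimately show ?thesis
      using that by blast
  qed
  have W0: "fps_nth (fps_of_poly W) 0 \<noteq> 0"
    using nz[of 0] s by (simp add: poly_0_coeff_0)
  have w_eq: "w = inverse (fps_of_poly W)"
    using w W0 by (metis fps_inverse_unique)
  have "poly W has_fps_expansion fps_of_poly W"
    unfolding has_fps_expansion_def by simp
  then have "(\<lambda>y. inverse (poly W y)) has_fps_expansion w"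
    unfolding w_eq using W0 by (rule has_fps_expansion_inverse)
  moreover have "(\<lambda>y. inverse (poly W y)) holomorphic_on eball 0 R"
    using R(2) by (intro holomorphic_intros) (auto simp: not_less)
  ultimately have "ereal R \<le> fps_conv_radius w"
    by (rule holomorphic_on_imp_fps_conv_radius_ge)
  then have rad: "ereal (norm x) < fps_conv_radius w"
    using x R(1) by (metis ereal_less(2) ereal_less_eq(3) le_less_trans less_ereal.simps(1) less_le_trans)
  have "eval_fps (fps_of_poly W * w) x = eval_fps (fps_of_poly W) x * eval_fps w x"
    using rad by (intro eval_fps_mult) auto
  then have "poly W x * eval_fps w x = 1"
    by (simp add: w)
  then have "eval_fps w x = 1 / poly W x"
    using nz[OF x] by (simp add: field_simps)
  then show ?thesis
    using sums_eval_fps[OF rad] by simp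
qed

text \<open>The series \<open>k = h (1 - cnj l X)\<close> keeps one of the two conjugate poles, and
  \<open>k_m / l^m\<close> is a partial sum of \<open>1 / W\<close> at \<open>1 / l\<close>. As the
  coefficients of \<open>h\<close> are real, the imaginary part of
  \<open>k_(m+1) = h_(m+1) - cnj l h_m\<close> is \<open>Im l\<close> times
  \<open>h_m\<close>.\<close>

lemma reciprocal_coeff_asymptotics:
  fixes Q W :: "complex poly" and g :: "nat \<Rightarrow> real"
  assumes Q: "Q = [:1, - l:] * ([:1, - cnj l:] * W)"
    and h: "h * fps_of_poly Q = 1" "\<And>m. fps_nth h m = of_real (g m)"
    and l: "Im l > 0" and W: "\<And>x. norm x \<le> 1 / norm l \<Longrightarrow> poly W x \<noteq> 0"
  shows "\<exists>\<kappa>. \<kappa> \<noteq> 0 \<and> (\<lambda>m. g m / norm l ^ m - Im (\<kappa> * (l / norm l) ^ m)) \<longlonglongrightarrow> 0"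
proof -
  define s u where "s = 1 / norm l" and "u = l / norm l"
  have ln: "l \<noteq> 0"
    using l by auto
  have s: "s > 0" and un: "norm u = 1" "u \<noteq> 0"
    using ln by (auto simp: s_def u_def norm_divide)
  have lu: "l = u / of_real s"
    using ln by (simp add: s_def u_def)
  define k where "k = h * (1 - fps_const (cnj l) * fps_X)"
  define w where "w = k * (1 - fps_const l * fps_X)"
  have Qf: "fps_of_poly Q = (1 - fps_const l * fps_X) * ((1 - fps_const (cnj l) * fps_X) * fps_of_poly W)"
    by (simp add: Q fps_of_poly_mult del: mult_pCons_left mult_pCons_right)
  have w: "fps_of_poly W * w = 1"
    using h(1) by (simp only: w_def k_def Qf mult_ac)
  have W1: "(\<lambda>n. fps_nth w n * (1 / l) ^ n) sums (1 / poly W (1 / l))"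
    using sums_reciprocal_poly[of "1 / norm l" W "1 / l", OF W _ w] by (simp add: norm_divide)
  define \<kappa>0 where "\<kappa>0 = 1 / poly W (1 / l)"
  have \<kappa>0: "\<kappa>0 \<noteq> 0"
    using W[of "1 / l"] by (simp add: \<kappa>0_def norm_divide)
  have knth: "fps_nth k m / l ^ m = (\<Sum>n\<le>m. fps_nth w n * (1 / l) ^ n)" for m
  proof (induction m)
    case 0
    then show ?case by (simp add: w_def)
  next
    case (Suc m)
    have "fps_nth w (Suc m) = fps_nth k (Suc m) - l * fps_nth k m"
      using fps_lin_mult_nth(2)[of w l k m] by (simp add: w_def mult.commute)
    then have "fps_nth k (Suc m) / l ^ Suc m = fps_nth w (Suc m) / l ^ Suc m + fps_nth k m / l ^ m"
      using ln by (simp add: field_simps)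
    then show ?case
      using Suc by (simp add: power_one_over del: power_Suc)
  qed
  have "(\<lambda>m. fps_nth k m / l ^ m) \<longlonglongrightarrow> \<kappa>0"
    unfolding knth \<kappa>0_def using W1 by (simp add: sums_def_le)
  then have "(\<lambda>m. fps_nth k m / l ^ m - \<kappa>0) \<longlonglongrightarrow> 0"
    by (rule LIM_zero)
  then have "(\<lambda>m. norm (fps_nth k (Suc m) / l ^ Suc m - \<kappa>0)) \<longlonglongrightarrow> 0"
    by (intro tendsto_norm_zero) (rule LIMSEQ_Suc)
  then have lim: "(\<lambda>m. norm (fps_nth k (Suc m) / l ^ Suc m - \<kappa>0) / (s * Im l)) \<longlonglongrightarrow> 0"
    by (rule tendsto_divide_zero)
  have Im_le: "norm (Im v / (s * Im l)) \<le> norm v / (s * Im l)" for v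
    using s l abs_Im_le_cmod[of v] by (simp add: abs_mult divide_right_mono)
  \<comment> \<open>The factor \<open>u / (s * Im l)\<close> accounts for the shift from
    \<open>m\<close> to \<open>Suc m\<close> and for the division by \<open>Im l\<close>.\<close>
  define \<kappa> where "\<kappa> = \<kappa>0 * u / of_real (s * Im l)"
  have "norm (g m / norm l ^ m - Im (\<kappa> * u ^ m)) \<le> norm (fps_nth k (Suc m) / l ^ Suc m - \<kappa>0) / (s * Im l)" for m
  proof -
    have "fps_nth k (Suc m) = fps_nth h (Suc m) - cnj l * fps_nth h m"
      using fps_lin_mult_nth(2)[of k "cnj l" h m] by (simp add: k_def mult.commute)
    then have "Im (fps_nth k (Suc m)) = Im l * g m"
      by (simp add: h(2))
    then have g: "g m = Im (fps_nth k (Suc m)) / Im l"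
      using l by simp
    have ls: "norm l = 1 / s"
      using ln by (simp add: s_def)
    have "g m / norm l ^ m = Im (fps_nth k (Suc m) * of_real (s ^ Suc m)) / (s * Im l)"
      unfolding ls using s l by (simp add: g power_one_over field_simps)
    also have "fps_nth k (Suc m) * of_real (s ^ Suc m) = fps_nth k (Suc m) / l ^ Suc m * u ^ Suc m"
      unfolding lu using un s by (simp add: power_divide field_simps)
    finally have e1: "g m / norm l ^ m = Im (fps_nth k (Suc m) / l ^ Suc m * u ^ Suc m) / (s * Im l)" .
    have e2: "Im (\<kappa> * u ^ m) = Im (\<kappa>0 * u ^ Suc m) / (s * Im l)"
      unfolding \<kappa>_def by (simp add: mult_ac Im_divide_of_real)
    have "g m / norm l ^ m - Im (\<kappa> * u ^ m) = Im ((fps_nth k (Suc m) / l ^ Suc m - \<kappa>0) * u ^ Suc m) / (s * Im l)"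
      unfolding e1 e2 by (simp only: left_diff_distrib minus_complex.sel diff_divide_distrib)
    also have "norm \<dots> \<le> norm ((fps_nth k (Suc m) / l ^ Suc m - \<kappa>0) * u ^ Suc m) / (s * Im l)"
      by (rule Im_le)
    also have "norm ((fps_nth k (Suc m) / l ^ Suc m - \<kappa>0) * u ^ Suc m) = norm (fps_nth k (Suc m) / l ^ Suc m - \<kappa>0)"
      using un by (simp only: norm_mult norm_power) simp
    finally show ?thesis .
  qed
  then have "(\<lambda>m. g m / norm l ^ m - Im (\<kappa> * u ^ m)) \<longlonglongrightarrow> 0"
    by (intro Lim_null_comparison[OF _ lim]) auto
  moreover have "\<kappa> \<noteq> 0"
    using \<kappa>0 un s l by (simp add: \<kappa>_def)
  ultimately show ?thesis
    unfolding u_def by blast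
qed

section \<open>Sampled sines and their signs\<close>

lemma rotation_recurrence:
  fixes u \<kappa> :: complex
  assumes "norm u = 1"
  shows "Im (\<kappa> * u ^ (n + 2)) = 2 * Re u * Im (\<kappa> * u ^ (n + 1)) - Im (\<kappa> * u ^ n)"
proof -
  have "u * cnj u = 1"
    using assms by (simp add: complex_norm_square [symmetric])
  then have "u ^ 2 = of_real (2 * Re u) * u - 1"
    unfolding complex_add_cnj [symmetric] by (simp add: power2_eq_square algebra_simps)
  then have "\<kappa> * u ^ n * u ^ 2 = of_real (2 * Re u) * (\<kappa> * u ^ (n + 1)) - \<kappa> * u ^ n"
    by (simp only:) (simp add: algebra_simps)
  moreover have "\<kappa> * u ^ n * u ^ 2 = \<kappa> * u ^ (n + 2)"
    by (simp only: power_add mult.assoc)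
  ultimately have "\<kappa> * u ^ (n + 2) = of_real (2 * Re u) * (\<kappa> * u ^ (n + 1)) - \<kappa> * u ^ n"
    by simp
  then show ?thesis
    by simp
qed

lemma rotation_consecutive_zeros:
  fixes u \<kappa> :: complex
  assumes "Im (\<kappa> * u ^ n) = 0" "Im (\<kappa> * u ^ (n + 1)) = 0" "Im u \<noteq> 0"
  shows "\<kappa> = 0"
proof -
  define v where "v = \<kappa> * u ^ n"
  have "Im v = 0" "Im (v * u) = 0"
    using assms by (simp_all add: v_def mult_ac)
  then have "v = 0"
    using assms(3) by (simp add: complex_eq_iff)
  then show ?thesis
    using assms(3) by (auto simp: v_def)
qed

text \<open>If the sampled sines had different frequencies, their Casoratian would be monotone and
  recurrent, hence constant, and the product of the sines would vanish identically.\<close>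

lemma rotation_same_sign:
  fixes u v \<kappa> \<mu> :: complex and p q :: "nat \<Rightarrow> real"
  assumes u: "norm u = 1" "Im u > 0" and v: "norm v = 1" "Im v > 0" and nz: "\<kappa> \<noteq> 0" "\<mu> \<noteq> 0"
    and p: "(\<lambda>m. p m - Im (\<kappa> * u ^ m)) \<longlonglongrightarrow> 0" and q: "(\<lambda>m. q m - Im (\<mu> * v ^ m)) \<longlonglongrightarrow> 0"
    and pq: "\<And>m. p m * q m \<ge> 0"
  shows "Re u = Re v"
proof (rule ccontr)
  assume ne: "Re u \<noteq> Re v"
  define x y where "x n = Im (\<kappa> * u ^ n)" and "y n = Im (\<mu> * v ^ n)" for n
  obtain N where N: "filterlim N at_top sequentially" "(\<lambda>k. u ^ N k) \<longlonglongrightarrow> 1" "(\<lambda>k. v ^ N k) \<longlonglongrightarrow> 1"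
    using unit_powers_return[OF u(1) v(1)] by blast
  have ret: "(\<lambda>k. Im (c * w ^ (j + N k))) \<longlonglongrightarrow> Im (c * w ^ j)" if "(\<lambda>k. w ^ N k) \<longlonglongrightarrow> 1" for c w :: complex and j
  proof -
    have "(\<lambda>k. Im (c * w ^ j * w ^ N k)) \<longlonglongrightarrow> Im (c * w ^ j * 1)"
      by (intro tendsto_intros that)
    then show ?thesis
      by (simp add: power_add mult_ac)
  qed
  have xret: "(\<lambda>k. x (j + N k)) \<longlonglongrightarrow> x j" and yret: "(\<lambda>k. y (j + N k)) \<longlonglongrightarrow> y j" for j
    unfolding x_def y_def using ret N by blast+
  have Nj: "filterlim (\<lambda>k. j + N k) at_top sequentially" for j
    by (rule filterlim_at_top_mono[OF N(1)]) auto
  have plim: "(\<lambda>k. p (j + N k)) \<longlonglongrightarrow> x j" for j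
  proof -
    have "(\<lambda>k. (p (j + N k) - x (j + N k)) + x (j + N k)) \<longlonglongrightarrow> 0 + x j"
      by (intro tendsto_add filterlim_compose[OF p[folded x_def] Nj] xret)
    then show ?thesis
      by simp
  qed
  have qlim: "(\<lambda>k. q (j + N k)) \<longlonglongrightarrow> y j" for j
  proof -
    have "(\<lambda>k. (q (j + N k) - y (j + N k)) + y (j + N k)) \<longlonglongrightarrow> 0 + y j"
      by (intro tendsto_add filterlim_compose[OF q[folded y_def] Nj] yret)
    then show ?thesis
      by simp
  qed
  \<comment> \<open>The error terms vanish along the return times, so the sign condition passes to
    the sines at every fixed index.\<close>
  have xy: "x j * y j \<ge> 0" for j
    by (rule LIMSEQ_le_const[OF tendsto_mult[OF plim qlim]]) (use pq in auto)
  have rx: "x (n + 2) = 2 * Re u * x (n + 1) - x n" for n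
    unfolding x_def by (rule rotation_recurrence[OF u(1)])
  have ry: "y (n + 2) = 2 * Re v * y (n + 1) - y n" for n
    unfolding y_def by (rule rotation_recurrence[OF v(1)])
  \<comment> \<open>The division by \<open>Re u - Re v\<close> turns the increments of the
    Casoratian into \<open>2 x y\<close>, which are nonnegative.\<close>
  define C where "C n = (x (n + 1) * y n - x n * y (n + 1)) / (Re u - Re v)" for n
  have Cstep: "C (Suc n) - C n = 2 * (x (n + 1) * y (n + 1))" for n
  proof -
    have "(x (n + 2) * y (n + 1) - x (n + 1) * y (n + 2)) - (x (n + 1) * y n - x n * y (n + 1))
        = 2 * (x (n + 1) * y (n + 1)) * (Re u - Re v)"
      unfolding rx ry by (simp add: algebra_simps)
    then show ?thesis
      using ne by (simp add: C_def diff_divide_distrib [symmetric])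
  qed
  have "incseq C"
    using Cstep xy by (intro incseq_SucI) (metis diff_ge_0_iff_ge mult_nonneg_nonneg zero_le_numeral)
  have Clim: "(\<lambda>k. C (0 + N k)) \<longlonglongrightarrow> C 0"
  proof -
    have "(\<lambda>k. (x (1 + N k) * y (0 + N k) - x (0 + N k) * y (1 + N k)) / (Re u - Re v))
        \<longlonglongrightarrow> (x 1 * y 0 - x 0 * y 1) / (Re u - Re v)"
      by (intro tendsto_intros xret yret) (use ne in simp)
    then show ?thesis
      by (simp add: C_def)
  qed
  have Cconst: "C n = C 0" for n
  proof (rule antisym)
    have "eventually (\<lambda>k. C n \<le> C (0 + N k)) sequentially"
      using N(1) unfolding filterlim_at_top
      by (rule allE[of _ n]) (auto elim!: eventually_mono intro: incseqD[OF \<open>incseq C\<close>])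
    then show "C n \<le> C 0"
      by (rule tendsto_lowerbound[OF Clim _ sequentially_bot])
    show "C 0 \<le> C n"
      using \<open>incseq C\<close> by (simp add: incseqD)
  qed
  have zero: "x n = 0 \<or> y n = 0" if "n \<ge> 1" for n
    using Cstep[of "n - 1"] Cconst[of n] Cconst[of "n - 1"] that by simp
  have xx: "\<not> (x n = 0 \<and> x (n + 1) = 0)" and yy: "\<not> (y n = 0 \<and> y (n + 1) = 0)" for n
    using rotation_consecutive_zeros[of \<kappa> u n] rotation_consecutive_zeros[of \<mu> v n] u v nz
    by (auto simp: x_def y_def)
  \<comment> \<open>As neither sequence has two consecutive zeros, the zeros alternate between them,
    and zeros at distance two force the coefficient of the recurrence to be 0, for both sequences.
    The letters \<open>a\<close> and \<open>b\<close> are generic because either sequence may be the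
    one that vanishes at 1.\<close>
  have False if zero: "\<And>n. n \<ge> 1 \<Longrightarrow> a n = 0 \<or> b n = (0::real)" and a1: "a 1 = 0"
    and aa: "\<And>n. \<not> (a n = 0 \<and> a (n + 1) = 0)" and bb: "\<And>n. \<not> (b n = 0 \<and> b (n + 1) = 0)"
    and ra: "\<And>n. a (n + 2) = 2 * \<rho> * a (n + 1) - a n" and rb: "\<And>n. b (n + 2) = 2 * \<sigma> * b (n + 1) - b n"
    and "\<rho> \<noteq> \<sigma>" for a b :: "nat \<Rightarrow> real" and \<rho> \<sigma>
  proof -
    have a2: "a 2 \<noteq> 0"
      using aa[of 1] a1 by (simp add: numeral_2_eq_2)
    then have b2: "b 2 = 0"
      using zero[of 2] by simp
    then have b3: "b 3 \<noteq> 0"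
      using bb[of 2] by (simp add: numeral_3_eq_3 numeral_2_eq_2)
    then have a3: "a 3 = 0"
      using zero[of 3] by simp
    then have a4: "a 4 \<noteq> 0"
      using aa[of 3] by simp
    then have b4: "b 4 = 0"
      using zero[of 4] by simp
    have "\<rho> = 0"
      using ra[of 1] a1 a2 a3 by (simp add: numeral_3_eq_3 numeral_2_eq_2)
    moreover have "\<sigma> = 0"
      using rb[of 2] b2 b3 b4 by simp
    ultimately show False
      using \<open>\<rho> \<noteq> \<sigma>\<close> by simp
  qed
  note contra = this
  consider "x 1 = 0" | "y 1 = 0"
    using zero[of 1] by auto
  then show False
  proof cases
    case 1
    then show False
      using contra[of x y "Re u" "Re v"] zero xx yy rx ry ne by blast
  next
    case 2
    then show False
      using contra[of y x "Re v" "Re u"] zero xx yy rx ry ne by metis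
  qed
qed

section \<open>Evaluating the generating relation at points\<close>

lemma generated_by_hom:
  fixes ev :: "real poly \<Rightarrow> 'a::comm_ring_1"
  assumes H: "generated_by H P r"
    and ev: "\<And>p q. ev (p + q) = ev p + ev q" "\<And>p q. ev (p * q) = ev p * ev q" "ev 0 = 0" "ev 1 = 1"
  shows "Abs_fps (\<lambda>m. ev (H m)) * (Abs_fps (\<lambda>k. ev [:poly.coeff P k:]) + fps_const (ev [:0, 1:]) * fps_X ^ r) = 1"
proof (rule fps_ext)
  fix n
  have ev_sum: "ev (\<Sum>i\<in>A. f i) = (\<Sum>i\<in>A. ev (f i))" for f :: "nat \<Rightarrow> real poly" and A
    by (induction A rule: infinite_finite_induct) (auto simp: ev)
  have d: "fps_nth (denom_fps P r) k = [:poly.coeff P k:] + [:0, 1:] * (if k = r then 1 else 0)" for k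
    unfolding denom_fps_def by (simp add: coeff_map_poly fps_X_power_nth)
  have d': "fps_nth (Abs_fps (\<lambda>k. ev [:poly.coeff P k:]) + fps_const (ev [:0, 1:]) * fps_X ^ r) k
      = ev (fps_nth (denom_fps P r) k)" for k
    unfolding d ev by (cases "k = r") (simp_all add: ev fps_X_power_nth)
  have "fps_nth (Abs_fps H * denom_fps P r) n = fps_nth 1 n"
    using H by (simp add: generated_by_def)
  then have "ev (\<Sum>i=0..n. H i * fps_nth (denom_fps P r) (n - i)) = ev (fps_nth 1 n)"
    by (simp add: fps_mult_nth)
  then have "(\<Sum>i=0..n. ev (H i) * ev (fps_nth (denom_fps P r) (n - i))) = fps_nth 1 n"
    unfolding ev_sum ev(2) by (simp add: ev split: if_splits)
  then show "fps_nth (Abs_fps (\<lambda>m. ev (H m)) * (Abs_fps (\<lambda>k. ev [:poly.coeff P k:]) + fps_const (ev [:0, 1:]) * fps_X ^ r)) n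
      = fps_nth 1 n"
    unfolding fps_mult_nth d' by simp
qed

lemma generated_by_complex:
  assumes "generated_by H P r"
  shows "Abs_fps (\<lambda>m. poly (map_poly complex_of_real (H m)) z)
    * (fps_of_poly (map_poly of_real P) + fps_const z * fps_X ^ r) = 1"
proof -
  have add: "map_poly complex_of_real (p + q) = map_poly of_real p + map_poly of_real q" for p q
    by (rule poly_eqI) (simp add: coeff_map_poly)
  have "fps_of_poly (map_poly complex_of_real P) = Abs_fps (\<lambda>k. poly (map_poly of_real [:poly.coeff P k:]) z)"
    by (rule fps_ext) (simp add: coeff_map_poly map_poly_pCons)
  then show ?thesis
    using generated_by_hom[OF assms, of "\<lambda>p. poly (map_poly of_real p) z"]
    by (simp add: add map_poly_of_real_mult map_poly_pCons)
qed

lemma generated_by_real: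
  assumes "generated_by H P r"
  shows "Abs_fps (\<lambda>m. poly (H m) x) * (fps_of_poly P + fps_const x * fps_X ^ r) = 1"
proof -
  have "fps_of_poly P = Abs_fps (\<lambda>k. poly [:poly.coeff P k:] x)"
    by (rule fps_ext) simp
  then show ?thesis
    using generated_by_hom[OF assms, of "\<lambda>p. poly p x"] by simp
qed

lemma poly_same_sign:
  fixes p :: "real poly"
  assumes "\<And>x. x \<in> {a<..<b} \<Longrightarrow> poly p x \<noteq> 0" "x \<in> {a<..<b}" "y \<in> {a<..<b}"
  shows "poly p x * poly p y > 0"
proof -
  have less: "poly p x * poly p y > 0" if "x < y" "x \<in> {a<..<b}" "y \<in> {a<..<b}" for x y
  proof (rule ccontr)
    assume "\<not> poly p x * poly p y > 0"
    moreover have "poly p x * poly p y \<noteq> 0"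
      using assms(1) that by simp
    ultimately have "poly p x * poly p y < 0"
      by linarith
    then obtain w where "x < w" "w < y" "poly p w = 0"
      using poly_IVT[OF \<open>x < y\<close>] by blast
    then show False
      using assms(1)[of w] that by auto
  qed
  then consider "x < y" | "y < x" | "x = y"
    by linarith
  then show ?thesis
  proof cases
    case 3
    then show ?thesis
      using assms(1)[OF assms(2)] by (auto simp: zero_less_mult_iff linorder_neq_iff)
  next
    case 1
    then show ?thesis
      using less assms(2,3) by blast
  next
    case 2
    then show ?thesis
      using less[of y x] assms(2,3) by (simp add: mult.commute)
  qed
qed

context positive_zeros
begin

lemma zeros_in_interval:
  assumes "generated_by H P r"
  shows "complex_zeros (H m) \<subseteq> real_interval (endpoint_a P r) (endpoint_b P r)"
proof
  fix z assume z: "z \<in> complex_zeros (H m)"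
  have "Im z = 0"
    by (rule reciprocal_coeff_zero_imp_real[OF as_pos _ c_pos r_pos P_def generated_by_complex[OF assms], where m = m])
       (use z in \<open>auto simp: complex_zeros_def\<close>)
  then obtain x where x: "z = of_real x"
    by (metis complex_is_Real_iff Reals_cases)
  have H0: "poly (H m) x = 0"
    using z by (simp add: x complex_zeros_def poly_map_poly_of_real)
  note gen = generated_by_real[OF assms, of x]
  have "endpoint_a P r < x"
  proof (rule ccontr)
    assume "\<not> endpoint_a P r < x"
    then have "\<exists>s. x \<le> 0 \<or> (0 < x \<and> s > 0 \<and> (\<forall>b\<in>set bs. b * s < 1) \<and> poly P s + x * s ^ r \<le> 0)"
      using endpoint_a_witness[of x] by (cases "x \<le> 0") auto
    then obtain s where "x \<le> 0 \<or> (0 < x \<and> s > 0 \<and> (\<forall>b\<in>set bs. b * s < 1) \<and> poly P s + x * s ^ r \<le> 0)"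
      by blast
    from reciprocal_coeff_pos_lower[OF c_pos \<alpha>_pos _ r_pos P_def gen this, of m] H0 bs
    show False
      by simp
  qed
  moreover have "ereal x < endpoint_b P r"
  proof (rule ccontr)
    assume n: "\<not> ereal x < endpoint_b P r"
    then have "r = 1"
      using endpoint_b_gt1 r_pos by (cases "r > 1") auto
    \<comment> \<open>For \<open>r = 1\<close>, the inequality \<open>b \<le> x\<close> read at
      \<open>t_b = - s\<close> is the hypothesis \<open>P(-s) \<le> x s\<close> of
      \<open>reciprocal_coeff_pos_upper\<close>.\<close>
    define s where "s = - t_b P r"
    have "s > 0"
      using t_b_1[OF \<open>r = 1\<close>] by (simp add: s_def)
    have "\<zeta> (- s) \<le> x"
      using n endpoint_b_1[OF \<open>r = 1\<close>] by (simp add: s_def)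
    moreover have "\<zeta> (- s) = poly P (- s) / s"
      unfolding \<zeta>_def using \<open>r = 1\<close> by simp
    ultimately have "poly P (- s) \<le> x * s"
      using \<open>s > 0\<close> by (simp add: divide_le_eq)
    moreover have "Abs_fps (\<lambda>m. poly (H m) x) * (fps_of_poly P + fps_const x * fps_X) = 1"
      using gen unfolding \<open>r = 1\<close> by simp
    ultimately have "(- 1) ^ m * fps_nth (Abs_fps (\<lambda>m. poly (H m) x)) m > 0"
      using reciprocal_coeff_pos_upper[OF c_pos as_pos P_def _ \<open>s > 0\<close>] by blast
    then show False
      using H0 by simp
  qed
  ultimately show "z \<in> real_interval (endpoint_a P r) (endpoint_b P r)"
    by (auto simp: real_interval_def x)
qed

text \<open>The smallest root is written as \<open>t = s * cnj u\<close>, so that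
  \<open>1 / t\<close> has direction \<open>u\<close>, and \<open>u\<close> governs the
  oscillation.\<close>

lemma H_asymptotics:
  assumes H: "generated_by H P r" and z: "endpoint_a P r < z" "ereal z < endpoint_b P r"
  shows "\<exists>u s \<kappa>. norm u = 1 \<and> Im u > 0 \<and> s > 0 \<and> \<kappa> \<noteq> 0 \<and> Pc (of_real s * cnj u) + of_real z * (of_real s * cnj u) ^ r = 0
    \<and> (\<lambda>m. poly (H m) z * s ^ m - Im (\<kappa> * u ^ m)) \<longlonglongrightarrow> 0"
proof -
  let ?z = "complex_of_real z"
  have z0: "z > 0"
    using endpoint_a_nonneg z by simp
  obtain t0 where t0: "min_root ?z t0"
    using min_root_exists by blast
  have im0: "Im t0 \<noteq> 0"
    by (rule min_root_nonreal[OF z t0])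
  have conj_root: "poly (Q ?z) (cnj t) = cnj (poly (Q ?z) t)" for t
    by (simp add: poly_Q Pc_cnj)
  \<comment> \<open>The member of the conjugate pair in the lower half plane, so that
    \<open>l = 1 / t\<close> has positive imaginary part.\<close>
  define t where "t = (if Im t0 < 0 then t0 else cnj t0)"
  have t: "min_root ?z t" "Im t < 0"
    using t0 im0 conj_root[of t0] by (auto simp: t_def min_root_def)
  have root: "poly (Q ?z) t = 0" "poly (Q ?z) (cnj t) = 0"
    using t(1) conj_root[of t] by (auto simp: min_root_def)
  have tn: "t \<noteq> 0" "t \<noteq> cnj t"
    using t(2) by (auto simp: complex_eq_iff)
  define l where "l = 1 / t"
  have l: "Im l > 0"
    using t(2) tn(1) by (simp add: l_def Im_divide sum_power2_gt_zero_iff complex_eq_iff divide_neg_pos)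
  have tl: "t = 1 / l" "cnj t = 1 / cnj l" "norm t = 1 / norm l"
    by (simp_all add: l_def norm_divide)
  obtain A where A: "Q ?z = [:- t, 1:] * A"
    using root(1) poly_eq_0_iff_dvd by (metis dvdE)
  have "poly A (cnj t) = 0"
    using root(2) tn(2) by (simp add: A)
  then obtain B where B: "A = [:- cnj t, 1:] * B"
    using poly_eq_0_iff_dvd by (metis dvdE)
  define W where "W = smult (t * cnj t) B"
  have lin: "[:- v, 1:] = smult (- v) [:1, - (1 / v):]" if "v \<noteq> 0" for v :: complex
    using that by simp
  have lin_t: "[:- t, 1:] = smult (- t) [:1, - l:]" "[:- cnj t, 1:] = smult (- cnj t) [:1, - cnj l:]"
    using lin[OF tn(1)] lin[of "cnj t"] tn(1) by (simp_all add: l_def)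
  have QW: "Q ?z = [:1, - l:] * ([:1, - cnj l:] * W)"
    unfolding A B W_def lin_t by (simp only: mult_smult_left mult_smult_right smult_smult minus_mult_minus mult.commute[of t "cnj t"])
  have simple: "poly (pderiv (Q ?z)) v \<noteq> 0" if "poly (Q ?z) v = 0" "Im v \<noteq> 0" for v
  proof -
    have "v \<noteq> 0"
      using that by auto
    then have "Pc v \<noteq> 0"
      using that(1) z0 by (auto simp: poly_Q)
    then show ?thesis
      by (rule nonreal_root_simple[OF that(2,1)])
  qed
  \<comment> \<open>A zero of \<open>W\<close> in this disc would be a root of \<open>Q\<close> of
    smallest modulus, hence \<open>t\<close> or \<open>cnj t\<close> once more, and thus a double
    root.\<close>
  have Wnz: "poly W x \<noteq> 0" if "norm x \<le> 1 / norm l" for x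
  proof
    assume W0: "poly W x = 0"
    then have Q0: "poly (Q ?z) x = 0"
      unfolding QW by simp
    then have "norm t \<le> norm x"
      using t(1) by (simp add: min_root_def)
    then have "norm t = norm x"
      using that tl(3) by linarith
    then have x: "x = t \<or> x = cnj t"
      using z0 by (intro Q_roots_on_circle[OF _ root(1) Q0]) auto
    have "poly ([:1, - l:] * [:1, - cnj l:]) x = (1 - l * x) * (1 - cnj l * x)"
      by (simp add: algebra_simps)
    moreover have "l * t = 1" "cnj l * cnj t = 1"
      using tn(1) by (simp_all add: l_def)
    ultimately have lin0: "poly ([:1, - l:] * [:1, - cnj l:]) x = 0"
      using x by (elim disjE) (simp_all only: diff_self mult_zero_left mult_zero_right)
    have "poly (pderiv (L * W)) x = 0" if "poly L x = 0" for L
      using W0 that by (simp add: pderiv_mult)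
    from this[OF lin0] have "poly (pderiv (Q ?z)) x = 0"
      by (simp only: QW mult.assoc)
    moreover have "Im x \<noteq> 0"
      using x t(2) by auto
    ultimately show False
      using simple[OF Q0] by blast
  qed
  define h where "h = Abs_fps (\<lambda>m. poly (map_poly complex_of_real (H m)) ?z)"
  have hQ: "h * fps_of_poly (Q ?z) = 1"
    using generated_by_complex[OF H, of ?z] by (simp add: h_def Q_def fps_of_poly_add fps_of_poly_monom)
  obtain \<kappa> where \<kappa>: "\<kappa> \<noteq> 0" "(\<lambda>m. poly (H m) z / norm l ^ m - Im (\<kappa> * (l / norm l) ^ m)) \<longlonglongrightarrow> 0"
    using reciprocal_coeff_asymptotics[OF QW hQ _ l Wnz, of "\<lambda>m. poly (H m) z"]
    by (auto simp: h_def poly_map_poly_of_real)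
  have ln: "l \<noteq> 0"
    using l by auto
  define u s where "u = l / norm l" and "s = 1 / norm l"
  have "of_real s * cnj u = t"
  proof -
    have "l * cnj l = of_real ((norm l)\<^sup>2)"
      by (rule complex_norm_square [symmetric])
    then have "cnj l / of_real ((norm l)\<^sup>2) = 1 / l"
      using ln by (simp add: field_simps)
    then show ?thesis
      by (simp add: u_def s_def tl(1) power2_eq_square)
  qed
  moreover have "Pc t + ?z * t ^ r = 0"
    using root(1) by (simp add: poly_Q)
  moreover have "(\<lambda>m. poly (H m) z * s ^ m - Im (\<kappa> * u ^ m)) \<longlonglongrightarrow> 0"
    using \<kappa>(2) by (simp add: u_def s_def power_one_over)
  moreover have "norm u = 1" "Im u > 0" "s > 0"
    using ln l by (simp_all add: u_def s_def norm_divide Im_divide_of_real)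
  ultimately show ?thesis
    using \<kappa>(1) by (intro exI[of _ u] exI[of _ s] exI[of _ \<kappa>]) simp
qed

text \<open>On the ray \<open>t = s * cnj u\<close> a root gives \<open>P(t) u^r = - z s^r\<close>,
  which is real, so \<open>s\<close> is a zero of the real polynomial \<open>E\<close>. Its two
  lowest coefficients are nonzero multiples of the imaginary parts of \<open>u^r\<close> and
  \<open>u^(r-1)\<close>, which cannot both vanish.\<close>

lemma roots_on_ray_finite:
  assumes "norm u = 1" "Im u > 0"
  shows "finite {s. \<exists>z. s > 0 \<and> Pc (of_real s * cnj u) + of_real z * (of_real s * cnj u) ^ r = 0}"
proof -
  define d where "d = Polynomial.degree P"
  define E where "E = (\<Sum>k\<le>d. monom (poly.coeff P k * Im (cnj u ^ k * u ^ r)) k)"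
  have uu: "cnj u * u = 1"
    using assms(1) by (simp add: complex_norm_square [symmetric] mult.commute)
  have P01: "poly.coeff P 0 \<noteq> 0" "poly.coeff P 1 \<noteq> 0"
    using coeff_lin_prod_alternating(2)[OF as_pos, of 0] coeff_lin_prod_alternating(2)[OF as_pos, of 1] c_pos
    by (auto simp: P_def simp del: lin_prod_simps)
  have coeffE: "poly.coeff E k = poly.coeff P k * Im (cnj u ^ k * u ^ r)" for k
  proof -
    have "poly.coeff E k = (if k \<le> d then poly.coeff P k * Im (cnj u ^ k * u ^ r) else 0)"
      by (simp add: E_def coeff_sum)
    then show ?thesis
      by (simp add: d_def coeff_eq_0)
  qed
  have "E \<noteq> 0"
  proof
    assume "E = 0"
    then have "Im (u ^ r) = 0" "Im (cnj u * u ^ r) = 0"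
      using coeffE[of 0] coeffE[of 1] P01 by simp_all
    moreover have "u ^ r = u * u ^ (r - 1)" 
      using r_pos by (cases r) auto
    then have "cnj u * u ^ r = u ^ (r - 1)"
      using uu by (simp flip: mult.assoc)
    ultimately have "Im (1 * u ^ (r - 1)) = 0" "Im (1 * u ^ (r - 1 + 1)) = 0"
      using r_pos by simp_all
    then show False
      using rotation_consecutive_zeros[of 1 u "r - 1"] assms(2) by simp
  qed
  have "poly E s = 0" if "s > 0" "Pc (of_real s * cnj u) + of_real z * (of_real s * cnj u) ^ r = 0" for s z
  proof -
    have "poly E s = (\<Sum>k\<le>d. poly.coeff P k * Im (cnj u ^ k * u ^ r) * s ^ k)"
      by (simp add: E_def poly_sum poly_monom)
    also have "\<dots> = Im (\<Sum>k\<le>d. of_real (poly.coeff P k) * (of_real s * cnj u) ^ k * u ^ r)"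
      unfolding Im_sum
    proof (intro sum.cong refl)
      fix k
      have "of_real (poly.coeff P k) * (of_real s * cnj u) ^ k * u ^ r
          = of_real (poly.coeff P k * s ^ k) * (cnj u ^ k * u ^ r)"
        by (simp add: power_mult_distrib mult_ac)
      then have "Im (of_real (poly.coeff P k) * (of_real s * cnj u) ^ k * u ^ r)
          = poly.coeff P k * s ^ k * Im (cnj u ^ k * u ^ r)"
        by (simp only: scaleR_conv_of_real [symmetric] scaleR_complex.sel)
      then show "poly.coeff P k * Im (cnj u ^ k * u ^ r) * s ^ k
          = Im (of_real (poly.coeff P k) * (of_real s * cnj u) ^ k * u ^ r)"
        by simp
    qed
    also have "(\<Sum>k\<le>d. of_real (poly.coeff P k) * (of_real s * cnj u) ^ k * u ^ r) = Pc (of_real s * cnj u) * u ^ r"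
      unfolding Pc_def poly_altdef sum_distrib_right
      by (intro sum.cong) (auto simp: d_def coeff_map_poly degree_map_poly)
    also have "Pc (of_real s * cnj u) = - (of_real z * (of_real s * cnj u) ^ r)"
      using that(2) by (simp add: eq_neg_iff_add_eq_0)
    also have "- (of_real z * (of_real s * cnj u) ^ r) * u ^ r = of_real (- (z * s ^ r)) * (cnj u * u) ^ r"
      by (simp add: power_mult_distrib mult_ac)
    also have "Im \<dots> = 0"
      unfolding uu by simp
    finally show ?thesis .
  qed
  then have "{s. \<exists>z. s > 0 \<and> Pc (of_real s * cnj u) + of_real z * (of_real s * cnj u) ^ r = 0} \<subseteq> {s. poly E s = 0}"
    by blast
  then show ?thesis
    using poly_roots_finite[OF \<open>E \<noteq> 0\<close>] finite_subset by blast
qed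

lemma zeros_dense:
  assumes H: "generated_by H P r"
  shows "real_interval (endpoint_a P r) (endpoint_b P r) \<subseteq> closure (\<Union>m. complex_zeros (H m))"
proof
  fix z assume "z \<in> real_interval (endpoint_a P r) (endpoint_b P r)"
  then obtain x0 where x0: "z = of_real x0" "endpoint_a P r < x0" "ereal x0 < endpoint_b P r"
    by (auto simp: real_interval_def)
  show "z \<in> closure (\<Union>m. complex_zeros (H m))"
    unfolding closure_approachable
  proof (rule allI, rule impI, rule ccontr)
    fix e :: real assume "e > 0" and no: "\<not> (\<exists>y\<in>\<Union>m. complex_zeros (H m). dist y z < e)"
    obtain y where y: "ereal x0 < ereal y" "ereal y < endpoint_b P r"
      using ereal_dense2[OF x0(3)] by auto
    \<comment> \<open>A one-sided interval suffices; \<open>d\<close> keeps it inside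
      \<open>(a, b)\<close> and within distance \<open>e\<close> of \<open>x0\<close>.\<close>
    define d where "d = min y (x0 + e)"
    have d: "x0 < d" "d \<le> x0 + e"
      using y(1) \<open>e > 0\<close> by (auto simp: d_def)
    have d_b: "ereal x < endpoint_b P r" if "x < d" for x
    proof -
      have "ereal x < ereal y"
        using that by (simp add: d_def)
      then show ?thesis
        using y(2) by (rule less_trans)
    qed
    have in_ab: "endpoint_a P r < x" "ereal x < endpoint_b P r" if "x \<in> {x0<..<d}" for x
      using that x0(2) d_b by auto
    have nz: "poly (H m) x \<noteq> 0" if "x \<in> {x0<..<d}" for m x
    proof
      assume "poly (H m) x = 0"
      then have "of_real x \<in> complex_zeros (H m)"
        by (simp add: complex_zeros_def poly_map_poly_of_real)
      moreover have "dist (complex_of_real x) z < e"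
        using that d(2) by (simp add: x0(1) dist_norm flip: of_real_diff)
      ultimately show False
        using no by blast
    qed
    define A where "A x u s \<kappa> \<longleftrightarrow> norm u = 1 \<and> Im u > 0 \<and> s > 0 \<and> \<kappa> \<noteq> 0
        \<and> Pc (of_real s * cnj u) + of_real x * (of_real s * cnj u) ^ r = 0
        \<and> (\<lambda>m. poly (H m) x * s ^ m - Im (\<kappa> * u ^ m)) \<longlonglongrightarrow> 0" for x u s \<kappa>
    have "\<forall>x\<in>{x0<..<d}. \<exists>u s \<kappa>. A x u s \<kappa>"
      using H_asymptotics[OF H in_ab] unfolding A_def by blast
    then obtain u where "\<forall>x\<in>{x0<..<d}. \<exists>s \<kappa>. A x (u x) s \<kappa>"
      by (rule bchoice[THEN exE])
    then obtain s where "\<forall>x\<in>{x0<..<d}. \<exists>\<kappa>. A x (u x) (s x) \<kappa>"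
      by (rule bchoice[THEN exE])
    then obtain \<kappa> where "\<forall>x\<in>{x0<..<d}. A x (u x) (s x) (\<kappa> x)"
      by (rule bchoice[THEN exE])
    then have f: "norm (u x) = 1" "Im (u x) > 0" "s x > 0" "\<kappa> x \<noteq> 0"
        "Pc (of_real (s x) * cnj (u x)) + of_real x * (of_real (s x) * cnj (u x)) ^ r = 0"
        "(\<lambda>m. poly (H m) x * s x ^ m - Im (\<kappa> x * u x ^ m)) \<longlonglongrightarrow> 0" if "x \<in> {x0<..<d}" for x
      using that by (auto simp only: A_def)
    obtain x1 where x1: "x1 \<in> {x0<..<d}"
      using dense[OF d(1)] by auto
    have u: "u x = u x1" if x: "x \<in> {x0<..<d}" for x
    proof -
      have "Re (u x) = Re (u x1)"
      proof (rule rotation_same_sign[OF f(1,2)[OF x] f(1,2)[OF x1] f(4)[OF x] f(4)[OF x1] f(6)[OF x] f(6)[OF x1]])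
        fix m
        have "poly (H m) x * poly (H m) x1 > 0"
          by (rule poly_same_sign[OF nz x x1])
        then have "poly (H m) x * poly (H m) x1 * (s x ^ m * s x1 ^ m) \<ge> 0"
          using f(3)[OF x] f(3)[OF x1] by simp
        then show "0 \<le> poly (H m) x * s x ^ m * (poly (H m) x1 * s x1 ^ m)"
          by (simp only: mult_ac)
      qed
      moreover from this have "(Im (u x))\<^sup>2 = (Im (u x1))\<^sup>2"
        using cmod_power2[of "u x"] cmod_power2[of "u x1"] f(1)[OF x] f(1)[OF x1] by simp
      then have "Im (u x) = Im (u x1)"
        using f(2)[OF x] f(2)[OF x1] by simp
      ultimately show ?thesis
        by (simp add: complex_eq_iff)
    qed
    have "s ` {x0<..<d} \<subseteq> {s. \<exists>z. s > 0 \<and> Pc (of_real s * cnj (u x1)) + of_real z * (of_real s * cnj (u x1)) ^ r = 0}"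
      using f(3,5) u by fastforce
    then have "finite (s ` {x0<..<d})"
      using roots_on_ray_finite[OF f(1,2)[OF x1]] finite_subset by blast
    \<comment> \<open>On the common ray \<open>s\<close> determines the root \<open>t\<close>, and
      \<open>t\<close> determines the parameter as \<open>- P(t) / t^r\<close>.\<close>
    moreover have "inj_on s {x0<..<d}"
    proof (rule inj_onI)
      fix x x' assume x: "x \<in> {x0<..<d}" "x' \<in> {x0<..<d}" and eq: "s x = s x'"
      let ?w = "of_real (s x) * cnj (u x1)"
      have "Pc ?w + of_real x * ?w ^ r = 0" "Pc ?w + of_real x' * ?w ^ r = 0"
        using f(5)[OF x(1)] f(5)[OF x(2)] u[OF x(1)] u[OF x(2)] eq by simp_all
      then have "(Pc ?w + of_real x * ?w ^ r) - (Pc ?w + of_real x' * ?w ^ r) = 0"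
        by (simp only:) simp
      then have "(of_real x - of_real x') * ?w ^ r = 0"
        unfolding left_diff_distrib by (simp only: add_diff_cancel_left)
      moreover have "?w \<noteq> 0"
        using f(2)[OF x1] f(3)[OF x(1)] by (auto simp: complex_eq_iff)
      ultimately show "x = x'"
        by simp
    qed
    ultimately have "finite {x0<..<d}"
      by (rule finite_imageD)
    then show False
      using d(1) by (simp add: infinite_Ioo)
  qed
qed

end

section \<open>Factoring the given polynomial, and the conclusion\<close>

lemma lin_prod_factorization:
  fixes p :: "real poly"
  assumes "p \<noteq> 0" "\<forall>z\<in>complex_zeros p. \<exists>x. x > 0 \<and> z = complex_of_real x"
  shows "\<exists>c as. p = smult c (lin_prod as) \<and> (\<forall>a\<in>set as. 0 < a) \<and> length as = Polynomial.degree p"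
  using assms
proof (induction "Polynomial.degree p" arbitrary: p)
  case 0
  then obtain c where "p = [:c:]"
    by (metis degree_eq_zeroE)
  then show ?case
    by (intro exI[of _ c] exI[of _ "[]"]) auto
next
  case (Suc n)
  have "Polynomial.degree (map_poly complex_of_real p) = Suc n"
    using Suc.hyps(2) by (simp add: degree_map_poly)
  then have "\<not> (\<exists>a l. a \<noteq> 0 \<and> l = 0 \<and> map_poly complex_of_real p = pCons a l)"
    by auto
  then obtain z where z: "z \<in> complex_zeros p"
    using fundamental_theorem_of_algebra_alt unfolding complex_zeros_def by blast
  then obtain x where x: "x > 0" "z = of_real x"
    using Suc.prems(2) by blast
  then have "poly p x = 0"
    using z by (simp add: complex_zeros_def poly_map_poly_of_real)
  then obtain q where q: "p = [:- x, 1:] * q"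
    using poly_eq_0_iff_dvd by (metis dvdE)
  have q0: "q \<noteq> 0"
    using q Suc.prems(1) by auto
  have dq: "Polynomial.degree p = Suc (Polynomial.degree q)"
    unfolding q using q0 by (subst degree_mult_eq) auto
  then have "n = Polynomial.degree q"
    using Suc.hyps(2) by simp
  moreover have "complex_zeros q \<subseteq> complex_zeros p"
    by (auto simp: complex_zeros_def q map_poly_of_real_mult simp del: mult_pCons_left)
  then have "\<forall>z\<in>complex_zeros q. \<exists>x. x > 0 \<and> z = complex_of_real x"
    using Suc.prems(2) by blast
  ultimately obtain c as where c: "q = smult c (lin_prod as)" "\<forall>a\<in>set as. 0 < a" "length as = Polynomial.degree q"
    using Suc.hyps(1)[OF _ q0] by blast
  have "[:- x, 1:] = smult (- x) [:1, - (1 / x):]"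
    using x by simp
  then have "p = smult (- x * c) (lin_prod (1 / x # as))"
    unfolding q c(1) by (simp only: lin_prod_simps mult_smult_left mult_smult_right smult_smult mult.commute[of c])
  then show ?case
    using c x dq by (intro exI[of _ "- x * c"] exI[of _ "1 / x # as"]) auto
qed

lemma lin_prod_remove1: "a \<in> set as \<Longrightarrow> lin_prod as = lin_prod (a # remove1 a as)"
proof (induction as)
  case (Cons b as)
  show ?case
  proof (cases "a = b")
    case False
    then have "lin_prod (b # as) = [:1, - b:] * ([:1, - a:] * lin_prod (remove1 a as))"
      using Cons by simp
    also have "\<dots> = [:1, - a:] * ([:1, - b:] * lin_prod (remove1 a as))"
      by (rule mult.left_commute)
    finally show ?thesis
      using False by simp
  qed simp
qed simp

theorem theorem1:
  fixes P :: "real poly" and r :: nat and H :: "nat \<Rightarrow> real poly"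
  assumes "degree P > 0"
    and "\<forall>z \<in> complex_zeros P. \<exists>x::real. x > 0 \<and> z = complex_of_real x"
    and "poly P 0 > 0"
    and "r > 0"
    and "max (degree P) r > 1"
    and "generated_by H P r"
  shows "\<exists>M::nat.
    (\<forall>m\<ge>M. complex_zeros (H m) \<subseteq> real_interval (endpoint_a P r) (endpoint_b P r)) \<and>
    real_interval (endpoint_a P r) (endpoint_b P r) \<subseteq> closure (\<Union>m\<in>{M..}. complex_zeros (H m))"
proof -
  have "P \<noteq> 0"
    using assms(3) by auto
  then obtain c as where as: "P = smult c (lin_prod as)" "\<forall>a\<in>set as. 0 < a" "length as = Polynomial.degree P"
    using lin_prod_factorization[OF _ assms(2)] by blast
  have ne: "as \<noteq> []"
    using as(3) assms(1) by auto
  define \<alpha> where "\<alpha> = Max (set as)"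
  define bs where "bs = remove1 \<alpha> as"
  have \<alpha>: "\<alpha> \<in> set as"
    unfolding \<alpha>_def using ne by (intro Max_in) auto
  have c: "c = poly P 0"
    unfolding as(1) poly_0_coeff_0 by simp
  interpret positive_zeros c \<alpha> bs r
  proof
    show "\<forall>b\<in>set bs. 0 < b \<and> b \<le> \<alpha>"
      using as(2) notin_set_remove1 by (fastforce simp: bs_def \<alpha>_def dest: set_remove1_subset[THEN subsetD])
    have "length bs = Polynomial.degree P - 1"
      using \<alpha> as(3) by (simp add: bs_def length_remove1)
    then show "1 < r \<or> bs \<noteq> []"
      using assms(5) by auto
  qed (use as(2) \<alpha> assms(3,4) c in auto)
  have P: "positive_zeros.P c \<alpha> bs = P"
    unfolding P_def unfolding bs_def lin_prod_remove1[OF \<alpha>, symmetric] by (rule as(1)[symmetric])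
  \<comment> \<open>Both halves hold with all indices included, so \<open>M = 0\<close>.\<close>
  have "{0..} = (UNIV :: nat set)"
    by auto
  then show ?thesis
    using zeros_in_interval[unfolded P, OF assms(6)] zeros_dense[unfolded P, OF assms(6)]
    by (intro exI[of _ 0]) auto
qed


end
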